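(* Let $\lambda,\mu,T>0$. Let $(f_t)_{t\ge0}$ and $(\tilde f_t)_{t\ge0}$ be the weak solutions of the thermostated Boltzmann-Kac equation starting from some possibly different probability measures $f_0$ and $\tilde f_0$ on $\mathbb{R}$. Then for all $t\ge0$ $$W_2^2(f_t,\tilde f_t)\le e^{-\frac{\mu}{2}t}\,W_2^2(f_0,\tilde f_0).$$ Consequently, taking $\tilde f_0=\gamma$, for all $t\ge0$ $$W_2^2(f_t,\gamma)\le e^{-\frac{\mu}{2}t}\,W_2^2(f_0,\gamma).$$
   Context: $\gamma(w)=(2\pi T)^{-1/2}e^{-w^2/(2T)}$ is the centered Gaussian density with variance $T$, also identified with the corresponding probability measure. For probability measures $f,g$ on $\mathbb{R}$, $W_2(f,g)=\big(\inf_{X,Y}\mathbb{E}[(X-Y)^2]\big)^{1/2}$, the infimum being over all pairs of random variables with $\mathrm{Law}(X)=f$, $\mathrm{Law}(Y)=g$; $W_2^2(f,g)$ denotes $W_2(f,g)^2$. Weak solution. Let $\mathcal{M}$ be the space of bounded non-negative Borel measures on $\mathbb{R}$, metrized by total variation. For $\nu_1,\nu_2\in\mathcal{M}$, let $B[\nu_1,\nu_2]\in\mathcal{M}$ be defined by $$\int_{\mathbb{R}}\phi(x)\,B[\nu_1,\nu_2](dx)=\int_{\mathbb{R}}\int_{\mathbb{R}}\nu_1(dx)\,\nu_2(dy)\int_0^{2\pi}\phi(x\cos\theta+y\sin\theta)\frac{d\theta}{2\pi}$$ for all bounded continuous $\phi$. A weak solution of the thermostated Boltzmann-Kac equation $\frac{df_t}{dt}=2\lambda(B[f_t,f_t]-f_t)+\mu(B[f_t,\gamma]-f_t)$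 with initial condition $f_0$ is a function $f\in C([0,\infty),\mathcal{M})$ such that for all $t\ge0$ $$f_t=f_0+\int_0^t\{2\lambda(B[f_s,f_s]-f_s)+\mu(B[f_s,\gamma]-f_s)\}\,ds.$$ For every probability measure $f_0$ there is a unique weak solution, and each $f_t$ is a probability measure. *)

theory Defs
  imports "HOL-Probability.Probability"
begin

definition gaussian :: "real \<Rightarrow> real measure" where
  "gaussian T = density lborel (\<lambda>w. ennreal (normal_density 0 (sqrt T) w))"

text \<open>The space of bounded non-negative Borel measures on the line is given by the predicate
  \<^const>\<open>finite_borel_measure\<close>; its metric is the total variation of the difference.\<close>

definition tv_dist :: "real measure \<Rightarrow> real measure \<Rightarrow> real" where
  "tv_dist \<nu>\<^sub>1 \<nu>\<^sub>2 =
     (SUP P \<in> {P. finite P \<and> partition_on UNIV P \<and> P \<subseteq> sets borel}.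
        \<Sum>A\<in>P. \<bar>measure \<nu>\<^sub>1 A - measure \<nu>\<^sub>2 A\<bar>)"

definition is_collision :: "real measure \<Rightarrow> real measure \<Rightarrow> real measure \<Rightarrow> bool" where
  "is_collision \<nu>\<^sub>1 \<nu>\<^sub>2 \<nu> \<longleftrightarrow>
     finite_borel_measure \<nu> \<and>
     (\<forall>\<phi>::real \<Rightarrow> real. continuous_on UNIV \<phi> \<longrightarrow> bounded (range \<phi>) \<longrightarrow>
        (LINT x|\<nu>. \<phi> x) =
        (LINT x|\<nu>\<^sub>1. LINT y|\<nu>\<^sub>2. (LINT \<theta>:{0..2*pi}|lborel. \<phi> (x * cos \<theta> + y * sin \<theta>) / (2*pi))))"

definition collision :: "real measure \<Rightarrow> real measure \<Rightarrow> real measure" where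
  "collision \<nu>\<^sub>1 \<nu>\<^sub>2 = (THE \<nu>. is_collision \<nu>\<^sub>1 \<nu>\<^sub>2 \<nu>)"

text \<open>The integral equation is an identity between finite signed measures; it is stated by
  evaluating both sides on every Borel set. By the continuity in total variation, the integrand
  is a continuous function of \<open>s\<close> with values in the Banach space of finite signed measures, and
  evaluation on a fixed Borel set is a bounded linear functional there, so it commutes with the
  time integral.\<close>

definition weak_solution ::
    "real \<Rightarrow> real \<Rightarrow> real \<Rightarrow> real measure \<Rightarrow> (real \<Rightarrow> real measure) \<Rightarrow> bool" where
  "weak_solution lam mu T f\<^sub>0 f \<longleftrightarrow>
     (\<forall>t\<ge>0. finite_borel_measure (f t)) \<and>
     (\<forall>t\<ge>0. ((\<lambda>s. tv_dist (f s) (f t)) \<longlongrightarrow> 0) (at t within {0..})) \<and>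
     (\<forall>t\<ge>0. \<forall>A\<in>sets borel.
        measure (f t) A = measure f\<^sub>0 A +
          (LINT s:{0..t}|lborel.
             2 * lam * (measure (collision (f s) (f s)) A - measure (f s) A)
             + mu * (measure (collision (f s) (gaussian T)) A - measure (f s) A)))"

definition ennreal_sqrt :: "ennreal \<Rightarrow> ennreal" where
  "ennreal_sqrt x = (if x = \<infinity> then \<infinity> else ennreal (sqrt (enn2real x)))"

text \<open>The distance may be infinite. Only the joint law of the pair matters, so it is no
  restriction to let the probability space live on the type of pairs of reals: any pair of
  random variables can be realised there as the coordinate projections under its joint law.\<close>

definition W2 :: "real measure \<Rightarrow> real measure \<Rightarrow> ennreal" where
  "W2 f g = ennreal_sqrt
     (INF (M, X, Y) \<in> {(M :: (real \<times> real) measure, X, Y).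
          prob_space M \<and> X \<in> borel_measurable M \<and> Y \<in> borel_measurable M \<and>
          distr M borel X = f \<and> distr M borel Y = g}.
        \<integral>\<^sup>+\<omega>. ennreal ((X \<omega> - Y \<omega>)\<^sup>2) \<partial>M)"

lemma ennreal_sqrt_power2: "(ennreal_sqrt x)\<^sup>2 = x"
  by (cases x) (auto simp: ennreal_sqrt_def ennreal_power top_power_ennreal)

text \<open>Sanity check for the definite description: on finite Borel measures the collision
  operator is well defined.\<close>

lemma finite_borel_measure_eqI_continuous:
  assumes M: "finite_borel_measure M" and N: "finite_borel_measure N"
  assumes eq: "\<And>\<phi>::real \<Rightarrow> real. continuous_on UNIV \<phi> \<Longrightarrow> bounded (range \<phi>) \<Longrightarrow>
                 (LINT x|M. \<phi> x) = (LINT x|N. \<phi> x)"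
  shows "M = N"
proof (rule cdf_unique'[OF M N], rule ext)
  fix x :: real
  let ?c = "\<lambda>n::nat. cts_step x (x + 1 / real (Suc n))"
  have cont: "continuous_on UNIV (?c n)" for n
    by (intro uniformly_continuous_imp_continuous cts_step_uniformly_continuous) simp
  have bd: "\<bar>?c n y\<bar> \<le> 1" for n y
  proof -
    have "\<bar>cts_step a b y\<bar> \<le> 1" if "a < b" for a b
      using that by (auto simp: cts_step_def abs_of_pos)
    then show ?thesis by simp
  qed
  have bdd: "bounded (range (?c n))" for n
    using bd by (auto simp: bounded_iff)
  have lim: "(\<lambda>n. ?c n y) \<longlonglongrightarrow> indicator {..x} y" for y
  proof (cases "y \<le> x")
    case True
    then show ?thesis by (simp add: cts_step_def)
  next
    case False
    have "(\<lambda>n. x + 1 / real (Suc n)) \<longlonglongrightarrow> x + 0"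
      by (intro tendsto_intros LIMSEQ_Suc lim_1_over_n)
    then have "\<forall>\<^sub>F n in sequentially. x + 1 / real (Suc n) < y"
      using False by (intro order_tendstoD(2)) auto
    then have "\<forall>\<^sub>F n in sequentially. ?c n y = indicator {..x} y"
      by eventually_elim (use False in \<open>auto simp: cts_step_def\<close>)
    then show ?thesis by (rule tendsto_eventually)
  qed
  have conv: "(\<lambda>n. LINT y|Q. ?c n y) \<longlonglongrightarrow> cdf Q x" if "finite_borel_measure Q" for Q
  proof -
    interpret finite_borel_measure Q by fact
    have [measurable_cong]: "sets Q = sets borel" by (rule M_is_borel)
    have "?c n \<in> borel_measurable borel" for n
      using cont by (rule borel_measurable_continuous_onI)
    then have meas: "?c n \<in> borel_measurable Q" for n
      by (simp cong: measurable_cong_sets add: M_is_borel)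
    have "(\<lambda>n. LINT y|Q. ?c n y) \<longlonglongrightarrow> (LINT y|Q. indicator {..x} y)"
      by (rule integral_dominated_convergence[where w = "\<lambda>_. 1"])
         (use meas bd lim in \<open>simp_all del: of_nat_Suc\<close>)
    then show ?thesis by (simp add: cdf_def)
  qed
  show "cdf M x = cdf N x"
    using conv[OF M] conv[OF N] eq[OF cont bdd] by (intro LIMSEQ_unique) auto
qed

lemma is_collision_distr:
  assumes "finite_borel_measure \<nu>\<^sub>1" "finite_borel_measure \<nu>\<^sub>2"
  shows "is_collision \<nu>\<^sub>1 \<nu>\<^sub>2
    (distr (\<nu>\<^sub>1 \<Otimes>\<^sub>M (\<nu>\<^sub>2 \<Otimes>\<^sub>M uniform_measure lborel {0..2*pi})) borel
       (\<lambda>(x, y, \<theta>). x * cos \<theta> + y * sin \<theta>))"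
    (is "is_collision _ _ (distr (_ \<Otimes>\<^sub>M (_ \<Otimes>\<^sub>M ?U)) _ ?h)")
proof -
  interpret N1: finite_borel_measure \<nu>\<^sub>1 by fact
  interpret N2: finite_borel_measure \<nu>\<^sub>2 by fact
  interpret U: prob_space ?U by (rule prob_space_uniform_measure) auto
  note [measurable_cong] = N1.M_is_borel N2.M_is_borel
  let ?P2 = "\<nu>\<^sub>2 \<Otimes>\<^sub>M ?U"
  let ?P = "\<nu>\<^sub>1 \<Otimes>\<^sub>M ?P2"
  interpret P2: finite_measure ?P2
    by (intro finite_measure_pair_measure N2.finite_measure_axioms U.finite_measure_axioms)
  interpret P: finite_measure ?P
    by (intro finite_measure_pair_measure N1.finite_measure_axioms P2.finite_measure_axioms)
  interpret PP2: pair_sigma_finite \<nu>\<^sub>2 ?U ..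
  interpret PP: pair_sigma_finite \<nu>\<^sub>1 ?P2 ..
  have [measurable]: "?h \<in> borel_measurable ?P" by measurable
  have fin: "finite_borel_measure (distr ?P borel ?h)"
    by (simp add: finite_borel_measure_def finite_borel_measure_axioms_def P.finite_measure_distr)
  have "(LINT x|distr ?P borel ?h. \<phi> x) =
        (LINT x|\<nu>\<^sub>1. LINT y|\<nu>\<^sub>2. (LINT \<theta>:{0..2*pi}|lborel. \<phi> (x * cos \<theta> + y * sin \<theta>) / (2*pi)))"
    if c: "continuous_on UNIV \<phi>" and b: "bounded (range \<phi>)" for \<phi> :: "real \<Rightarrow> real"
  proof -
    have [measurable]: "\<phi> \<in> borel_measurable borel"
      using c by (rule borel_measurable_continuous_onI)
    obtain K where K: "\<And>x. \<bar>\<phi> x\<bar> \<le> K" using b by (auto simp: bounded_iff)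
    have "(LINT x|distr ?P borel ?h. \<phi> x) = (LINT z|?P. \<phi> (?h z))"
      by (rule integral_distr) measurable
    also have "\<dots> = (LINT x|\<nu>\<^sub>1. LINT w|?P2. \<phi> (?h (x, w)))"
      by (rule PP.integral_fst'[symmetric], rule P.integrable_const_bound[where B = K])
         (use K in auto)
    also have "\<dots> = (LINT x|\<nu>\<^sub>1. LINT y|\<nu>\<^sub>2. LINT \<theta>|?U. \<phi> (x * cos \<theta> + y * sin \<theta>))"
    proof (rule Bochner_Integration.integral_cong[OF refl])
      fix x
      have "(LINT w|?P2. \<phi> (?h (x, w))) = (LINT y|\<nu>\<^sub>2. LINT \<theta>|?U. \<phi> (?h (x, y, \<theta>)))"
        by (rule PP2.integral_fst'[symmetric], rule P2.integrable_const_bound[where B = K])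
           (use K in auto)
      then show "(LINT w|?P2. \<phi> (?h (x, w))) =
                 (LINT y|\<nu>\<^sub>2. LINT \<theta>|?U. \<phi> (x * cos \<theta> + y * sin \<theta>))" by simp
    qed
    also have "(\<lambda>x y. LINT \<theta>|?U. \<phi> (x * cos \<theta> + y * sin \<theta>)) =
        (\<lambda>x y. LINT \<theta>:{0..2*pi}|lborel. \<phi> (x * cos \<theta> + y * sin \<theta>) / (2*pi))"
    proof (intro ext)
      fix x y
      have U_eq: "?U = density lborel (\<lambda>\<theta>. ennreal (indicator {0..2*pi} \<theta> / (2*pi)))"
        unfolding uniform_measure_def
        by (rule density_cong) (auto simp: divide_ennreal indicator_def ennreal_1[symmetric]
              simp del: ennreal_1)
      show "(LINT \<theta>|?U. \<phi> (x * cos \<theta> + y * sin \<theta>)) =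
            (LINT \<theta>:{0..2*pi}|lborel. \<phi> (x * cos \<theta> + y * sin \<theta>) / (2*pi))"
        unfolding U_eq set_lebesgue_integral_def
        by (subst integral_density) (auto simp: field_simps)
    qed
    finally show ?thesis .
  qed
  with fin show ?thesis unfolding is_collision_def by blast
qed

lemma ex1_is_collision:
  assumes "finite_borel_measure \<nu>\<^sub>1" "finite_borel_measure \<nu>\<^sub>2"
  shows "\<exists>!\<nu>. is_collision \<nu>\<^sub>1 \<nu>\<^sub>2 \<nu>"
proof (rule ex_ex1I)
  show "\<exists>\<nu>. is_collision \<nu>\<^sub>1 \<nu>\<^sub>2 \<nu>" using is_collision_distr[OF assms] by blast
next
  fix M N assume "is_collision \<nu>\<^sub>1 \<nu>\<^sub>2 M" "is_collision \<nu>\<^sub>1 \<nu>\<^sub>2 N"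
  then show "M = N"
    unfolding is_collision_def by (intro finite_borel_measure_eqI_continuous) auto
qed

end

theory Submission
  imports Defs
begin

text \<open>With \<open>a = 2\<lambda> + \<mu>\<close>, \<open>p = 2\<lambda> / a\<close> and \<open>x = 1 - exp (- a t)\<close>, the solution is the Wild sum
  \<open>f\<^sub>t = (1 - x) \<Sum>\<^sub>n x\<^sup>n Q\<^sub>n\<close>, where \<open>Q\<^sub>0 = f\<^sub>0\<close> and \<open>Q\<^sub>n\<^sub>+\<^sub>1\<close> is the average over \<open>k \<le> n\<close> of
  \<open>p B[Q\<^sub>k, Q\<^sub>n\<^sub>-\<^sub>k] + (1 - p) B[Q\<^sub>k, \<gamma>]\<close>. The same recursion on the plane, started from a coupling of the two
  initial laws and thermostated by the diagonal Gaussian, produces couplings of the terms of both Wild sums.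
  Averaging over the common angle removes the cross term, so the cost of the \<open>n\<close>-th term is the initial
  cost times \<open>(b)\<^sub>n / n!\<close> with \<open>b = (1 + p) / 2\<close>. By the binomial series the coupling of
  \<open>f\<^sub>t\<close> and \<open>g\<^sub>t\<close> has cost \<open>(1 - x) (1 - x)\<^sup>-\<^sup>b = exp (- \<mu> t / 2)\<close> times the initial one.\<close>

section \<open>The collision operator\<close>

text \<open>The loss terms of the equation add up to \<open>a\<close> times the solution, and
  \<open>p\<close> is the share of that rate due to collisions inside the system, so
  \<open>a * p = 2 * lam\<close> and \<open>a * (1 - p) = mu\<close>. In the variable
  \<open>x\<close> the gain term is \<open>(1 - x)^2\<close> times the derivative of a power series,
  which is where the average over \<open>k\<close> with denominator \<open>n + 1\<close> comes from.
  Because the cost of the coupling is known exactly for every initial coupling, the infimum is taken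
  only at the very end, and optimal couplings and their measurable dependence on time never enter.
  The price is that a given weak solution must be identified with the Wild sum. It is known only to
  consist of finite measures and is described one Borel set at a time, so uniqueness is obtained
  from bounds that hold on all Borel sets simultaneously and improve under iteration. The statement
  about the Gaussian follows from the one about two solutions because a rotation preserves the law
  of two independent centered Gaussians of equal variance, which makes the constant path at the
  Gaussian a weak solution.\<close>

definition angle :: "real measure" where
  "angle = uniform_measure lborel {0..2*pi}"

lemma prob_space_angle: "prob_space angle"
  unfolding angle_def by (rule prob_space_uniform_measure) auto

lemma sets_angle[simp, measurable_cong]: "sets angle = sets borel"
  by (simp add: angle_def)

lemma space_angle[simp]: "space angle = UNIV"
  by (simp add: angle_def)

text \<open>Over a full turn \<open>cos^2\<close> and \<open>sin^2\<close> both have mean 1/2 and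
  \<open>cos * sin\<close> has mean 0. This is the only property of the angle law that the cost
  estimate uses.\<close>

lemma nn_integral_angle_second_moment:
  "(\<integral>\<^sup>+\<theta>. ennreal ((cos \<theta> * u + sin \<theta> * v)\<^sup>2) \<partial>angle) = ennreal ((u\<^sup>2 + v\<^sup>2) / 2)"
proof -
  \<comment> \<open>An antiderivative of the integrand, found from the double angle formulas; its
    increment over a full period comes from the linear term alone.\<close>
  define F where "F \<theta> = (u\<^sup>2 + v\<^sup>2) / 2 * \<theta> + (u\<^sup>2 - v\<^sup>2) / 2 * (sin \<theta> * cos \<theta>) + u * v * (sin \<theta>)\<^sup>2" for \<theta>
  have D: "(F has_real_derivative (cos \<theta> * u + sin \<theta> * v)\<^sup>2) (at \<theta>)" for \<theta>
  proof -
    have "((\<lambda>\<theta>. a * \<theta> + b * (sin \<theta> * cos \<theta>) + c * (sin \<theta>)\<^sup>2) has_real_derivative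
        a + b * (cos \<theta> * cos \<theta> - sin \<theta> * sin \<theta>) + c * (2 * sin \<theta> * cos \<theta>)) (at \<theta>)" for a b c
      by (auto intro!: derivative_eq_intros simp: algebra_simps)
    then have "(F has_real_derivative (u\<^sup>2 + v\<^sup>2) / 2 + (u\<^sup>2 - v\<^sup>2) / 2 * (cos \<theta> * cos \<theta> - sin \<theta> * sin \<theta>)
        + u * v * (2 * sin \<theta> * cos \<theta>)) (at \<theta>)"
      unfolding F_def .
    also have "(u\<^sup>2 + v\<^sup>2) / 2 = (u\<^sup>2 + v\<^sup>2) / 2 * ((cos \<theta>)\<^sup>2 + (sin \<theta>)\<^sup>2)"
      by simp
    also have "\<dots> + (u\<^sup>2 - v\<^sup>2) / 2 * (cos \<theta> * cos \<theta> - sin \<theta> * sin \<theta>)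
        + u * v * (2 * sin \<theta> * cos \<theta>) = (cos \<theta> * u + sin \<theta> * v)\<^sup>2"
      by (simp add: power2_eq_square field_simps del: sin_cos_squared_add sin_cos_squared_add2 sin_cos_squared_add3)
    finally show ?thesis .
  qed
  have "(\<integral>\<^sup>+\<theta>. ennreal ((cos \<theta> * u + sin \<theta> * v)\<^sup>2) \<partial>angle)
      = (\<integral>\<^sup>+\<theta>. ennreal ((cos \<theta> * u + sin \<theta> * v)\<^sup>2) * indicator {0..2*pi} \<theta> \<partial>lborel) / emeasure lborel {0..2*pi}"
    unfolding angle_def by (rule nn_integral_uniform_measure) auto
  also have "(\<integral>\<^sup>+\<theta>. ennreal ((cos \<theta> * u + sin \<theta> * v)\<^sup>2) * indicator {0..2*pi} \<theta> \<partial>lborel)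
      = ennreal (F (2*pi) - F 0)"
    by (rule nn_integral_FTC_Icc) (auto intro: D)
  finally show ?thesis
    by (simp add: F_def divide_ennreal field_simps)
qed

text \<open>The collision operator, over an arbitrary normed space so that couplings on the plane
  and their marginals on the line are treated alike.\<close>

definition rot_conv ::
    "'a::{real_normed_vector, second_countable_topology} measure \<Rightarrow> 'a measure \<Rightarrow> 'a measure" where
  "rot_conv M N = distr (M \<Otimes>\<^sub>M (N \<Otimes>\<^sub>M angle)) borel (\<lambda>(x, y, \<theta>). cos \<theta> *\<^sub>R x + sin \<theta> *\<^sub>R y)"

lemma collision_eq_rot_conv:
  assumes "finite_borel_measure M" "finite_borel_measure N"
  shows "collision M N = rot_conv M N"
proof -
  have "collision M N = distr (M \<Otimes>\<^sub>M (N \<Otimes>\<^sub>M uniform_measure lborel {0..2*pi})) borel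
       (\<lambda>(x, y, \<theta>). x * cos \<theta> + y * sin \<theta>)"
    unfolding collision_def
    by (rule the1_equality[OF ex1_is_collision is_collision_distr]) (use assms in auto)
  then show ?thesis
    by (simp add: rot_conv_def angle_def mult.commute)
qed

lemma sets_rot_conv[simp, measurable_cong]: "sets (rot_conv M N) = sets borel"
  by (simp add: rot_conv_def)

lemma rotation_measurable:
  fixes M N :: "'a::{real_normed_vector, second_countable_topology} measure"
  assumes [measurable_cong]: "sets M = sets borel" "sets N = sets borel"
  shows "(\<lambda>(x, y, \<theta>). cos \<theta> *\<^sub>R x + sin \<theta> *\<^sub>R y) \<in> borel_measurable (M \<Otimes>\<^sub>M (N \<Otimes>\<^sub>M angle))"
  by measurable

lemma rot_conv_prob_algebra:
  fixes M N :: "'a::{real_normed_vector, second_countable_topology} measure"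
  assumes "M \<in> space (prob_algebra borel)" "N \<in> space (prob_algebra borel)"
  shows "rot_conv M N \<in> space (prob_algebra borel)"
  using assms unfolding space_prob_algebra rot_conv_def
  by (auto intro!: prob_space.prob_space_distr prob_space_pair rotation_measurable prob_space_angle)

text \<open>Tonelli with the angle innermost, so that averages over the angle can be computed for
  fixed \<open>x\<close> and \<open>y\<close>.\<close>

lemma nn_integral_rot_conv:
  fixes M N :: "'a::{real_normed_vector, second_countable_topology} measure"
  assumes M: "finite_measure M" and N: "finite_measure N"
    and [measurable_cong]: "sets M = sets borel" "sets N = sets borel"
    and [measurable]: "h \<in> borel_measurable borel"
  shows "(\<integral>\<^sup>+z. h z \<partial>rot_conv M N) = (\<integral>\<^sup>+x. \<integral>\<^sup>+y. \<integral>\<^sup>+\<theta>. h (cos \<theta> *\<^sub>R x + sin \<theta> *\<^sub>R y) \<partial>angle \<partial>N \<partial>M)"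
proof -
  interpret A: prob_space angle by (rule prob_space_angle)
  interpret N: finite_measure N by fact
  interpret P: finite_measure "N \<Otimes>\<^sub>M angle"
    by (intro finite_measure_pair_measure N A.finite_measure_axioms)
  have "(\<integral>\<^sup>+z. h z \<partial>rot_conv M N) =
      (\<integral>\<^sup>+w. h ((\<lambda>(x, y, \<theta>). cos \<theta> *\<^sub>R x + sin \<theta> *\<^sub>R y) w) \<partial>(M \<Otimes>\<^sub>M (N \<Otimes>\<^sub>M angle)))"
    unfolding rot_conv_def by (rule nn_integral_distr) (measurable)
  also have "\<dots> = (\<integral>\<^sup>+x. \<integral>\<^sup>+q. h ((\<lambda>(x, y, \<theta>). cos \<theta> *\<^sub>R x + sin \<theta> *\<^sub>R y) (x, q)) \<partial>(N \<Otimes>\<^sub>M angle) \<partial>M)"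
    by (rule P.nn_integral_fst[symmetric]) measurable
  also have "\<dots> = (\<integral>\<^sup>+x. \<integral>\<^sup>+y. \<integral>\<^sup>+\<theta>. h (cos \<theta> *\<^sub>R x + sin \<theta> *\<^sub>R y) \<partial>angle \<partial>N \<partial>M)"
  proof (rule nn_integral_cong)
    fix x
    show "(\<integral>\<^sup>+q. h ((\<lambda>(x, y, \<theta>). cos \<theta> *\<^sub>R x + sin \<theta> *\<^sub>R y) (x, q)) \<partial>(N \<Otimes>\<^sub>M angle)) =
        (\<integral>\<^sup>+y. \<integral>\<^sup>+\<theta>. h (cos \<theta> *\<^sub>R x + sin \<theta> *\<^sub>R y) \<partial>angle \<partial>N)"
      using A.nn_integral_fst[of "\<lambda>q. h (cos (snd q) *\<^sub>R x + sin (snd q) *\<^sub>R fst q)" N]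
      by (simp add: case_prod_beta)
  qed
  finally show ?thesis .
qed

lemma emeasure_rot_conv:
  fixes M N :: "'a::{real_normed_vector, second_countable_topology} measure"
  assumes "finite_measure M" "finite_measure N" "sets M = sets borel" "sets N = sets borel"
    and [measurable]: "A \<in> sets borel"
  shows "emeasure (rot_conv M N) A =
    (\<integral>\<^sup>+x. \<integral>\<^sup>+y. \<integral>\<^sup>+\<theta>. indicator A (cos \<theta> *\<^sub>R x + sin \<theta> *\<^sub>R y) \<partial>angle \<partial>N \<partial>M)"
  using nn_integral_rot_conv[OF assms(1-4), of "indicator A"] by simp

text \<open>A linear map commutes with the combination of \<open>x\<close> and \<open>y\<close> at
  each fixed angle. For the two coordinate projections this says that the marginals of a collision
  on the plane, with one angle shared by both coordinates, are the collisions of the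
  marginals.\<close>

lemma distr_rot_conv:
  fixes M N :: "'a::{real_normed_vector, second_countable_topology} measure"
    and L :: "'a \<Rightarrow> 'b::{real_normed_vector, second_countable_topology}"
  assumes "finite_measure M" "finite_measure N"
    and [measurable_cong]: "sets M = sets borel" "sets N = sets borel"
    and L: "linear L" and [measurable]: "L \<in> borel_measurable borel"
  shows "distr (rot_conv M N) borel L = rot_conv (distr M borel L) (distr N borel L)"
proof (rule measure_eqI)
  fix A assume "A \<in> sets (distr (rot_conv M N) borel L)"
  then have [measurable]: "A \<in> sets borel" by simp
  have "emeasure (distr (rot_conv M N) borel L) A = (\<integral>\<^sup>+z. indicator A (L z) \<partial>rot_conv M N)"
    by (subst nn_integral_indicator[symmetric], simp, rule nn_integral_distr) measurable
  also have "\<dots> = (\<integral>\<^sup>+x. \<integral>\<^sup>+y. \<integral>\<^sup>+\<theta>. indicator A (cos \<theta> *\<^sub>R L x + sin \<theta> *\<^sub>R L y) \<partial>angle \<partial>N \<partial>M)"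
    by (subst nn_integral_rot_conv) (use assms in \<open>auto simp: linear_add linear_scale\<close>)
  also have "\<dots> = emeasure (rot_conv (distr M borel L) (distr N borel L)) A"
  proof -
    interpret A: prob_space angle by (rule prob_space_angle)
    interpret N: finite_measure N by fact
    interpret NL: finite_measure "distr N borel L" by (rule N.finite_measure_distr) measurable
    have "emeasure (rot_conv (distr M borel L) (distr N borel L)) A
      = (\<integral>\<^sup>+x. \<integral>\<^sup>+y. \<integral>\<^sup>+\<theta>. indicator A (cos \<theta> *\<^sub>R x + sin \<theta> *\<^sub>R y) \<partial>angle \<partial>distr N borel L \<partial>distr M borel L)"
      by (rule emeasure_rot_conv) (use assms in \<open>auto intro!: finite_measure.finite_measure_distr\<close>)
    also have "\<dots> = (\<integral>\<^sup>+x. \<integral>\<^sup>+y. \<integral>\<^sup>+\<theta>. indicator A (cos \<theta> *\<^sub>R L x + sin \<theta> *\<^sub>R y) \<partial>angle \<partial>distr N borel L \<partial>M)"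
      by (rule nn_integral_distr) measurable
    also have "\<dots> = (\<integral>\<^sup>+x. \<integral>\<^sup>+y. \<integral>\<^sup>+\<theta>. indicator A (cos \<theta> *\<^sub>R L x + sin \<theta> *\<^sub>R L y) \<partial>angle \<partial>N \<partial>M)"
      by (intro nn_integral_cong nn_integral_distr) measurable
    finally show ?thesis by simp
  qed
  finally show "emeasure (distr (rot_conv M N) borel L) A =
    emeasure (rot_conv (distr M borel L) (distr N borel L)) A" .
qed simp

section \<open>Transport cost of a coupling on the plane\<close>

definition quadratic_cost :: "(real \<times> real) measure \<Rightarrow> ennreal" where
  "quadratic_cost F = (\<integral>\<^sup>+z. ennreal ((fst z - snd z)\<^sup>2) \<partial>F)"

lemma quadratic_cost_measurable:
  "(\<lambda>z. ennreal ((fst z - snd z)\<^sup>2)) \<in> borel_measurable (borel :: (real \<times> real) measure)"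
  by (intro measurable_compose[OF borel_measurable_continuous_onI measurable_ennreal] continuous_intros)

text \<open>Averaging over the angle kills the cross term pointwise, so infinite costs need no
  separate treatment.\<close>

lemma quadratic_cost_rot_conv:
  assumes "F \<in> space (prob_algebra borel)" "G \<in> space (prob_algebra borel)"
  shows "quadratic_cost (rot_conv F G) = (quadratic_cost F + quadratic_cost G) / 2"
proof -
  interpret F: prob_space F using assms(1) by (simp add: space_prob_algebra)
  interpret G: prob_space G using assms(2) by (simp add: space_prob_algebra)
  have [measurable_cong]: "sets F = sets borel" "sets G = sets borel"
    using assms by (simp_all add: space_prob_algebra)
  note [measurable] = quadratic_cost_measurable
  have div: "(\<integral>\<^sup>+z. ennreal ((fst z - snd z)\<^sup>2) / 2 \<partial>F) = quadratic_cost F / 2"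
    "(\<integral>\<^sup>+z. ennreal ((fst z - snd z)\<^sup>2) / 2 \<partial>G) = quadratic_cost G / 2"
    unfolding quadratic_cost_def by (rule nn_integral_divide; measurable)+
  have half: "ennreal ((a + b) / 2) = ennreal a / 2 + ennreal b / 2" if "a \<ge> 0" "b \<ge> 0" for a b
    using that by (simp add: add_divide_distrib divide_ennreal[symmetric])
  have "quadratic_cost (rot_conv F G) = (\<integral>\<^sup>+x. \<integral>\<^sup>+y. \<integral>\<^sup>+\<theta>.
     ennreal ((cos \<theta> * (fst x - snd x) + sin \<theta> * (fst y - snd y))\<^sup>2) \<partial>angle \<partial>G \<partial>F)"
    unfolding quadratic_cost_def
    by (subst nn_integral_rot_conv[OF _ _ _ _ quadratic_cost_measurable])
       (auto simp: F.finite_measure_axioms G.finite_measure_axioms \<open>sets F = sets borel\<close> \<open>sets G = sets borel\<close> algebra_simps)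
  also have "\<dots> = (\<integral>\<^sup>+x. \<integral>\<^sup>+y. ennreal ((fst x - snd x)\<^sup>2) / 2 + ennreal ((fst y - snd y)\<^sup>2) / 2 \<partial>G \<partial>F)"
    by (simp add: nn_integral_angle_second_moment half)
  also have "\<dots> = (\<integral>\<^sup>+x. ennreal ((fst x - snd x)\<^sup>2) / 2 + quadratic_cost G / 2 \<partial>F)"
    by (subst nn_integral_add) (auto simp: div G.emeasure_space_1)
  also have "\<dots> = quadratic_cost F / 2 + quadratic_cost G / 2"
    by (subst nn_integral_add) (auto simp: div F.emeasure_space_1)
  finally show ?thesis by (simp add: add_divide_distrib_ennreal)
qed

section \<open>Wild sums and their cost\<close>

text \<open>The test \<open>k \<le> n\<close> always succeeds on the support of the uniform law; it is there for the
  termination proof.\<close>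

fun wild :: "real \<Rightarrow> 'a::{real_normed_vector, second_countable_topology} measure \<Rightarrow> 'a measure
    \<Rightarrow> nat \<Rightarrow> 'a measure" where
  "wild p G F 0 = F"
| "wild p G F (Suc n) = measure_pmf (pmf_of_set {..n}) \<bind> (\<lambda>k. if k \<le> n
     then measure_pmf (bernoulli_pmf p) \<bind> (\<lambda>b. rot_conv (wild p G F k) (if b then wild p G F (n - k) else G))
     else G)"

section \<open>Mixtures over discrete laws\<close>

lemma measurable_pmf_prob_algebra:
  "(\<And>x. K x \<in> space (prob_algebra N)) \<Longrightarrow> K \<in> measure_pmf q \<rightarrow>\<^sub>M prob_algebra N"
  by simp

lemma bind_pmf_prob_algebra:
  assumes "\<And>x. K x \<in> space (prob_algebra N)"
  shows "measure_pmf q \<bind> K \<in> space (prob_algebra N)"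
proof -
  have "measure_pmf q \<in> space (prob_algebra (count_space UNIV))"
    by (simp add: space_prob_algebra measure_pmf.prob_space_axioms)
  then show ?thesis
    using prob_space_bind'[of "measure_pmf q" "count_space UNIV" K N]
      sets_bind'[of "measure_pmf q" "count_space UNIV" K N] assms
    by (simp add: space_prob_algebra[of N])
qed

lemma nn_integral_bind_pmf:
  assumes "\<And>x. K x \<in> space (prob_algebra N)" "h \<in> borel_measurable N"
  shows "(\<integral>\<^sup>+z. h z \<partial>(measure_pmf q \<bind> K)) = (\<integral>\<^sup>+x. \<integral>\<^sup>+z. h z \<partial>K x \<partial>measure_pmf q)"
  by (rule nn_integral_bind[OF assms(2)])
     (intro measurable_prob_algebraD measurable_pmf_prob_algebra assms)

lemma distr_bind_pmf:
  assumes "\<And>x. K x \<in> space (prob_algebra N)" "h \<in> N \<rightarrow>\<^sub>M R"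
  shows "distr (measure_pmf q \<bind> K) R h = measure_pmf q \<bind> (\<lambda>x. distr (K x) R h)"
  by (rule distr_bind[OF measurable_prob_algebraD[OF measurable_pmf_prob_algebra] _ assms(2)])
     (simp_all add: assms)

section \<open>Wild terms: recursion, linear images and cost\<close>

lemma wild_prob_algebra:
  assumes "G \<in> space (prob_algebra borel)" "F \<in> space (prob_algebra borel)"
  shows "wild p G F n \<in> space (prob_algebra borel)"
proof (induction n rule: less_induct)
  case (less n)
  show ?case
  proof (cases n)
    case (Suc m)
    then have IH: "k \<le> m \<Longrightarrow> wild p G F k \<in> space (prob_algebra borel)" for k
      using less by auto
    show ?thesis
      unfolding Suc wild.simps
      by (rule bind_pmf_prob_algebra) (auto intro!: bind_pmf_prob_algebra rot_conv_prob_algebra IH assms)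
  qed (use assms in simp)
qed

lemma wild_finite_measure:
  assumes "G \<in> space (prob_algebra borel)" "F \<in> space (prob_algebra borel)"
  shows "finite_measure (wild p G F n)" "sets (wild p G F n) = sets borel"
  using wild_prob_algebra[OF assms, of p n]
  by (auto simp: space_prob_algebra prob_space.finite_measure)

text \<open>Kept for a general nonnegative \<open>h\<close> because it is applied twice: to the
  squared distance for the cost recursion and to indicators for the evolution of the masses.\<close>

lemma nn_integral_wild_Suc:
  assumes G: "G \<in> space (prob_algebra borel)" and F: "F \<in> space (prob_algebra borel)"
    and h: "h \<in> borel_measurable borel" and p: "0 \<le> p" "p \<le> 1"
  shows "(\<integral>\<^sup>+z. h z \<partial>wild p G F (Suc n)) = (\<Sum>k\<le>n.
     ennreal p * (\<integral>\<^sup>+z. h z \<partial>rot_conv (wild p G F k) (wild p G F (n - k)))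
     + ennreal (1 - p) * (\<integral>\<^sup>+z. h z \<partial>rot_conv (wild p G F k) G)) / ennreal (real (Suc n))"
proof -
  note W = wild_prob_algebra[OF G F]
  have "(\<integral>\<^sup>+z. h z \<partial>wild p G F (Suc n)) = (\<Sum>k\<le>n. \<integral>\<^sup>+z. h z \<partial>(measure_pmf (bernoulli_pmf p) \<bind>
        (\<lambda>b. rot_conv (wild p G F k) (if b then wild p G F (n - k) else G)))) / ennreal (real (Suc n))"
    unfolding wild.simps
    by (subst nn_integral_bind_pmf[OF _ h])
       (auto intro!: bind_pmf_prob_algebra rot_conv_prob_algebra W G simp: nn_integral_pmf_of_set
         ennreal_of_nat_eq_real_of_nat simp del: of_nat_Suc)
  also have "\<dots> = (\<Sum>k\<le>n.
     ennreal p * (\<integral>\<^sup>+z. h z \<partial>rot_conv (wild p G F k) (wild p G F (n - k)))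
     + ennreal (1 - p) * (\<integral>\<^sup>+z. h z \<partial>rot_conv (wild p G F k) G)) / ennreal (real (Suc n))"
    using p
    by (subst nn_integral_bind_pmf[OF _ h])
       (auto intro!: rot_conv_prob_algebra W G simp: mult.commute simp del: of_nat_Suc)
  finally show ?thesis .
qed

lemma distr_prob_algebra:
  assumes "M \<in> space (prob_algebra borel)" "L \<in> borel_measurable borel"
  shows "distr M borel L \<in> space (prob_algebra borel)"
proof -
  interpret M: prob_space M using assms by (simp add: space_prob_algebra)
  have [measurable_cong]: "sets M = sets borel" using assms by (simp add: space_prob_algebra)
  show ?thesis
    using assms by (auto simp: space_prob_algebra intro!: M.prob_space_distr)
qed

text \<open>The recursion is built from mixtures and collisions only, and a linear image passes
  through both. The induction is strong because each term involves all the earlier ones.\<close>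

lemma distr_wild:
  fixes L :: "'a::{real_normed_vector, second_countable_topology} \<Rightarrow> 'b::{real_normed_vector, second_countable_topology}"
  assumes G: "G \<in> space (prob_algebra borel)" and F: "F \<in> space (prob_algebra borel)"
    and L: "linear L" "L \<in> borel_measurable borel"
  shows "distr (wild p G F n) borel L = wild p (distr G borel L) (distr F borel L) n"
proof (induction n rule: less_induct)
  case (less n)
  have fin: "finite_measure G" "sets G = sets borel"
    using G by (auto simp: space_prob_algebra prob_space.finite_measure)
  show ?case
  proof (cases n)
    case (Suc m)
    note W = wild_prob_algebra[OF G F]
    have *: "distr (measure_pmf (bernoulli_pmf p) \<bind>
         (\<lambda>b. rot_conv (wild p G F k) (if b then wild p G F (m - k) else G))) borel L =
       measure_pmf (bernoulli_pmf p) \<bind> (\<lambda>b. rot_conv (wild p (distr G borel L) (distr F borel L) k)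
         (if b then wild p (distr G borel L) (distr F borel L) (m - k) else distr G borel L))"
      if "k \<le> m" for k
    proof -
      have IH: "distr (wild p G F j) borel L = wild p (distr G borel L) (distr F borel L) j" if "j \<le> m" for j
        using less[of j] that Suc by auto
      show ?thesis
        by (subst distr_bind_pmf[OF _ L(2)], (auto intro!: rot_conv_prob_algebra W G)[1],
            intro bind_cong refl, subst distr_rot_conv)
           (use that in \<open>auto simp: L fin wild_finite_measure[OF G F] IH\<close>)
    qed
    have "distr (wild p G F (Suc m)) borel L = measure_pmf (pmf_of_set {..m}) \<bind> (\<lambda>k. distr (if k \<le> m
     then measure_pmf (bernoulli_pmf p) \<bind> (\<lambda>b. rot_conv (wild p G F k) (if b then wild p G F (m - k) else G))
     else G) borel L)"
      unfolding wild.simps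
      by (rule distr_bind_pmf[OF _ L(2)]) (auto intro!: bind_pmf_prob_algebra rot_conv_prob_algebra W G)
    also have "\<dots> = wild p (distr G borel L) (distr F borel L) (Suc m)"
      unfolding wild.simps by (intro bind_cong refl) (auto simp: *)
    finally show ?thesis using Suc by simp
  qed simp
qed

text \<open>Coefficient form of \<open>(1 - x) * y' = b * y\<close> for
  \<open>y = (1 - x) powr (- b)\<close>: the partial sums are the coefficients of
  \<open>y / (1 - x)\<close>, and the right-hand side is the coefficient of
  \<open>y'\<close>.\<close>

lemma sum_pochhammer_div_fact:
  fixes b :: real
  shows "b * (\<Sum>k\<le>n. pochhammer b k / fact k) = real (Suc n) * (pochhammer b (Suc n) / fact (Suc n))"
proof (induction n)
  case (Suc n)
  have "b * (\<Sum>k\<le>Suc n. pochhammer b k / fact k) =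
      (b + real (Suc n)) * (pochhammer b (Suc n) / fact (Suc n))"
    by (subst sum.atMost_Suc) (simp only: distrib_left distrib_right Suc.IH)
  also have "\<dots> = real (Suc (Suc n)) * (pochhammer b (Suc (Suc n)) / fact (Suc (Suc n)))"
    by (simp add: pochhammer_Suc[of b "Suc n"] fact_Suc[of "Suc n"] del: fact_Suc)
  finally show ?case .
qed simp

text \<open>A collision averages the two costs and the thermostat has cost 0. Writing
  \<open>c k\<close> for the costs, \<open>(n + 1) * c (n + 1)\<close> is the sum over
  \<open>k\<close> of \<open>p * (c k + c (n - k)) / 2 + (1 - p) * c k / 2\<close>. Reversing the
  index in the \<open>n - k\<close> part turns this into \<open>(1 + p) / 2\<close> times the sum of
  the \<open>c k\<close>, the recursion of the rising factorials.\<close>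

lemma quadratic_cost_wild:
  assumes G: "G \<in> space (prob_algebra borel)" and F: "F \<in> space (prob_algebra borel)"
    and p: "0 \<le> p" "p \<le> 1" and G0: "quadratic_cost G = 0"
  shows "quadratic_cost (wild p G F n) =
    ennreal (pochhammer ((1 + p) / 2) n / fact n) * quadratic_cost F"
proof (induction n rule: less_induct)
  case (less n)
  let ?c = "quadratic_cost F"
  define r where "r k = pochhammer ((1 + p) / 2) k / fact k" for k
  have r0: "r k \<ge> 0" for k
    unfolding r_def using p by (auto intro!: divide_nonneg_pos pochhammer_nonneg)
  show ?case
  proof (cases n)
    case (Suc m)
    note W = wild_prob_algebra[OF G F]
    have IH: "quadratic_cost (wild p G F j) = ennreal (r j) * ?c" if "j \<le> m" for j
      using less[of j] that Suc by (auto simp: r_def)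
    \<comment> \<open>These identities only ever collect \<open>?c\<close> as a common factor; since
      \<open>?c\<close> may be infinite, it is never cancelled.\<close>
    have half: "(ennreal x * ?c + ennreal y * ?c) / 2 = ennreal ((x + y) / 2) * ?c"
      if "x \<ge> 0" "y \<ge> 0" for x y
      using that by (simp add: divide_ennreal[symmetric] ennreal_plus ring_distribs divide_ennreal_def mult_ac
          flip: distrib_left distrib_right)
    have mean: "(\<Sum>k\<in>A. ennreal (g k) * ?c) / ennreal s = ennreal ((\<Sum>k\<in>A. g k) / s) * ?c"
      if "\<And>k. g k \<ge> 0" "s > 0" for g s and A :: "nat set"
    proof -
      have "(\<Sum>k\<in>A. ennreal (g k) * ?c) / ennreal s = ennreal (\<Sum>k\<in>A. g k) * ?c / ennreal s"
        by (simp add: sum_distrib_right[symmetric] that(1))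
      also have "\<dots> = (ennreal (\<Sum>k\<in>A. g k) / ennreal s) * ?c"
        by (simp add: divide_ennreal_def mult_ac)
      also have "ennreal (\<Sum>k\<in>A. g k) / ennreal s = ennreal ((\<Sum>k\<in>A. g k) / s)"
        by (rule divide_ennreal) (auto intro: sum_nonneg that)
      finally show ?thesis .
    qed
    have mix: "ennreal p * (ennreal A * ?c) + ennreal (1 - p) * (ennreal B * ?c) = ennreal (p * A + (1 - p) * B) * ?c"
      if "A \<ge> 0" "B \<ge> 0" for A B
      using that p by (simp add: ennreal_mult distrib_right mult.assoc)
    have "quadratic_cost (wild p G F n) = (\<Sum>k\<le>m.
        ennreal p * quadratic_cost (rot_conv (wild p G F k) (wild p G F (m - k)))
        + ennreal (1 - p) * quadratic_cost (rot_conv (wild p G F k) G)) / ennreal (real (Suc m))"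
      unfolding Suc quadratic_cost_def
      by (rule nn_integral_wild_Suc[OF G F quadratic_cost_measurable p])
    also have "\<dots> = (\<Sum>k\<le>m. ennreal (p * ((r k + r (m - k)) / 2) + (1 - p) * (r k / 2)) * ?c)
        / ennreal (real (Suc m))"
    proof (intro arg_cong2[where f = "(/)"] refl sum.cong)
      fix k assume "k \<in> {..m}"
      then have "ennreal p * quadratic_cost (rot_conv (wild p G F k) (wild p G F (m - k)))
        + ennreal (1 - p) * quadratic_cost (rot_conv (wild p G F k) G)
        = ennreal p * (ennreal ((r k + r (m - k)) / 2) * ?c) + ennreal (1 - p) * (ennreal (r k / 2) * ?c)"
        using half[OF r0[of k] r0[of "m - k"]] half[OF r0[of k] order_refl]
        by (simp add: quadratic_cost_rot_conv W G IH G0)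
      also have "\<dots> = ennreal (p * ((r k + r (m - k)) / 2) + (1 - p) * (r k / 2)) * ?c"
        by (rule mix) (auto intro!: add_nonneg_nonneg r0)
      finally show "ennreal p * quadratic_cost (rot_conv (wild p G F k) (wild p G F (m - k)))
        + ennreal (1 - p) * quadratic_cost (rot_conv (wild p G F k) G)
        = ennreal (p * ((r k + r (m - k)) / 2) + (1 - p) * (r k / 2)) * ?c" .
    qed
    also have "\<dots> = ennreal ((\<Sum>k\<le>m. p * ((r k + r (m - k)) / 2) + (1 - p) * (r k / 2)) / real (Suc m)) * ?c"
    proof -
      have nn: "0 \<le> p * ((r k + r (m - k)) / 2) + (1 - p) * (r k / 2)" for k
        using p r0 by simp
      show ?thesis
        by (rule mean) (use nn in auto)
    qed
    also have "(\<Sum>k\<le>m. p * ((r k + r (m - k)) / 2) + (1 - p) * (r k / 2)) = (1 + p) / 2 * (\<Sum>k\<le>m. r k)"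
    proof -
      have "(\<Sum>k\<le>m. r (m - k)) = (\<Sum>k\<le>m. r k)"
        using sum.nat_diff_reindex[of r "Suc m"] by (simp add: lessThan_Suc_atMost)
      moreover have "(\<Sum>k\<le>m. p * ((r k + r (m - k)) / 2) + (1 - p) * (r k / 2)) =
          1 / 2 * (\<Sum>k\<le>m. r k) + p / 2 * (\<Sum>k\<le>m. r (m - k))"
        unfolding sum_distrib_left sum.distrib[symmetric]
        by (intro sum.cong refl) (simp add: field_simps)
      ultimately show ?thesis by (simp add: ring_distribs add_divide_distrib)
    qed
    also have "\<dots> / real (Suc m) = r n"
      unfolding r_def sum_pochhammer_div_fact Suc
      by (rule nonzero_mult_div_cancel_left) simp
    finally show ?thesis by (simp only: r_def)
  next
    case 0
    show ?thesis
      unfolding 0 by (simp only: wild.simps pochhammer_0 fact_0 div_by_1 ennreal_1 mult_1_left)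
  qed
qed

text \<open>For \<open>0 \<le> x < 1\<close> the law \<open>geometric_pmf (1 - x)\<close> counts
  failures before the first success and gives \<open>n\<close> the mass
  \<open>(1 - x) * x ^ n\<close>. Written as a mixture of probability measures, the series is a
  probability measure by construction.\<close>

definition wild_sum :: "real \<Rightarrow> 'a::{real_normed_vector, second_countable_topology} measure \<Rightarrow> 'a measure
    \<Rightarrow> real \<Rightarrow> 'a measure" where
  "wild_sum p G F x = measure_pmf (geometric_pmf (1 - x)) \<bind> wild p G F"

lemma wild_sum_prob_algebra:
  assumes "G \<in> space (prob_algebra borel)" "F \<in> space (prob_algebra borel)"
  shows "wild_sum p G F x \<in> space (prob_algebra borel)"
  unfolding wild_sum_def by (intro bind_pmf_prob_algebra wild_prob_algebra assms)

lemma distr_wild_sum: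
  assumes G: "G \<in> space (prob_algebra borel)" and F: "F \<in> space (prob_algebra borel)"
    and L: "linear L" "L \<in> borel_measurable borel"
  shows "distr (wild_sum p G F x) borel L = wild_sum p (distr G borel L) (distr F borel L) x"
proof -
  have "distr (wild_sum p G F x) borel L =
      measure_pmf (geometric_pmf (1 - x)) \<bind> (\<lambda>n. distr (wild p G F n) borel L)"
    unfolding wild_sum_def by (rule distr_bind_pmf[OF wild_prob_algebra[OF G F] L(2)])
  also have "(\<lambda>n. distr (wild p G F n) borel L) = wild p (distr G borel L) (distr F borel L)"
    by (rule ext) (rule distr_wild[OF assms])
  finally show ?thesis by (simp only: wild_sum_def)
qed

lemma nn_integral_wild_sum:
  assumes "G \<in> space (prob_algebra borel)" "F \<in> space (prob_algebra borel)"
    and "h \<in> borel_measurable borel" and x: "0 \<le> x" "x < 1"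
  shows "(\<integral>\<^sup>+z. h z \<partial>wild_sum p G F x) = (\<Sum>n. ennreal ((1 - x) * x ^ n) * (\<integral>\<^sup>+z. h z \<partial>wild p G F n))"
  unfolding wild_sum_def using x
  by (subst nn_integral_bind_pmf[OF wild_prob_algebra[OF assms(1,2)] assms(3)])
     (simp add: nn_integral_measure_pmf nn_integral_count_space_nat mult.commute)

text \<open>Newton's binomial series for exponent \<open>- b\<close> at \<open>- x\<close>: the sign
  of the generalized binomial coefficient cancels against that of \<open>(- x) ^ n\<close>.\<close>

lemma sums_pochhammer:
  fixes b x :: real
  assumes "\<bar>x\<bar> < 1"
  shows "(\<lambda>n. pochhammer b n / fact n * x ^ n) sums (1 - x) powr (- b)"
proof -
  have "(\<lambda>n. ((- b) gchoose n) * (- x) ^ n) sums (1 + - x) powr (- b)"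
    by (rule gen_binomial_real) (use assms in simp)
  moreover have "((- b) gchoose n) * (- x) ^ n = pochhammer b n / fact n * x ^ n" for n
    by (simp add: gbinomial_pochhammer power_mult_distrib[symmetric] flip: mult.assoc)
  ultimately show ?thesis by simp
qed

lemma quadratic_cost_wild_sum:
  assumes G: "G \<in> space (prob_algebra borel)" and F: "F \<in> space (prob_algebra borel)"
    and p: "0 \<le> p" "p \<le> 1" and G0: "quadratic_cost G = 0" and x: "0 \<le> x" "x < 1"
  shows "quadratic_cost (wild_sum p G F x) = ennreal ((1 - x) powr ((1 - p) / 2)) * quadratic_cost F"
proof -
  let ?r = "\<lambda>n. pochhammer ((1 + p) / 2) n / fact n :: real"
  have r0: "?r k \<ge> 0" for k
    using p by (auto intro!: divide_nonneg_pos pochhammer_nonneg)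
  have "(\<lambda>n. (1 - x) * (?r n * x ^ n)) sums ((1 - x) * (1 - x) powr (- ((1 + p) / 2)))"
    using x by (intro sums_mult sums_pochhammer) auto
  also have "(1 - x) * (1 - x) powr (- ((1 + p) / 2)) = (1 - x) powr (1 + - ((1 + p) / 2))"
    using x by (subst powr_add) simp
  \<comment> \<open>After the time change this exponent is multiplied by \<open>a\<close>, and
    \<open>a * (1 - p) / 2\<close> is \<open>mu / 2\<close>.\<close>
  also have "1 + - ((1 + p) / 2) = (1 - p) / 2"
    by (simp add: field_simps)
  finally have sums: "(\<lambda>n. (1 - x) * (?r n * x ^ n)) sums (1 - x) powr ((1 - p) / 2)" .
  have "(1 - x) * (?r n * x ^ n) \<ge> 0" for n
    by (rule mult_nonneg_nonneg[OF _ mult_nonneg_nonneg[OF r0 zero_le_power]]) (use x in auto)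
  then have S: "(\<Sum>n. ennreal ((1 - x) * (?r n * x ^ n))) = ennreal ((1 - x) powr ((1 - p) / 2))"
    using sums by (rule suminf_ennreal_eq)
  have "quadratic_cost (wild_sum p G F x) = (\<Sum>n. ennreal ((1 - x) * x ^ n) * quadratic_cost (wild p G F n))"
    unfolding quadratic_cost_def by (rule nn_integral_wild_sum[OF G F quadratic_cost_measurable x])
  also have "\<dots> = (\<Sum>n. ennreal ((1 - x) * (?r n * x ^ n)) * quadratic_cost F)"
  proof (rule suminf_cong)
    fix n
    have "ennreal ((1 - x) * (?r n * x ^ n)) = ennreal ((1 - x) * x ^ n) * ennreal (?r n)"
      using x by (subst ennreal_mult[symmetric]) (auto simp: r0 mult_ac)
    then show "ennreal ((1 - x) * x ^ n) * quadratic_cost (wild p G F n) =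
        ennreal ((1 - x) * (?r n * x ^ n)) * quadratic_cost F"
      by (simp only: quadratic_cost_wild[OF G F p G0] mult.assoc)
  qed
  also have "\<dots> = ennreal ((1 - x) powr ((1 - p) / 2)) * quadratic_cost F"
    using S by simp
  finally show ?thesis .
qed

section \<open>The evolution equation of a Wild sum\<close>

text \<open>Row \<open>k\<close> is shifted right by \<open>k\<close> places and padded with zeros,
  after which the two sums are swapped by Tonelli for counting measures. Values in
  \<open>ennreal\<close> make this free of convergence conditions.\<close>

lemma suminf_antidiagonal:
  fixes f :: "nat \<Rightarrow> nat \<Rightarrow> ennreal"
  shows "(\<Sum>k. \<Sum>l. f k l) = (\<Sum>n. \<Sum>k\<le>n. f k (n - k))"
proof -
  define g where "g k n = (if k \<le> n then f k (n - k) else 0)" for k n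
  have "(\<Sum>k. \<Sum>l. f k l) = (\<Sum>k. \<Sum>n. g k n)"
  proof (rule suminf_cong)
    fix k
    have "(\<Sum>n. g k n) = (\<Sum>j. g k (j + k)) + (\<Sum>j<k. g k j)"
      by (rule suminf_offset) (rule summableI)
    then show "(\<Sum>l. f k l) = (\<Sum>n. g k n)"
      by (simp add: g_def)
  qed
  also have "\<dots> = (\<Sum>n. \<Sum>k. g k n)"
    using nn_integral_fst_count_space[of "\<lambda>(k, n). g k n"] nn_integral_snd_count_space[of "\<lambda>(k, n). g k n"]
    by (simp add: nn_integral_count_space_nat)
  also have "\<dots> = (\<Sum>n. \<Sum>k\<le>n. f k (n - k))"
  proof (rule suminf_cong)
    fix n
    have "(\<Sum>k. g k n) = (\<Sum>k\<le>n. g k n)"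
      by (rule suminf_finite) (auto simp: g_def)
    then show "(\<Sum>k. g k n) = (\<Sum>k\<le>n. f k (n - k))"
      by (simp add: g_def)
  qed
  finally show ?thesis .
qed

text \<open>For a fixed partner \<open>N\<close> the collision integrates one measurable function of
  the first variable, so the mixture comes straight out.\<close>

lemma emeasure_rot_conv_wild_sum_left:
  fixes G :: "'a::{real_normed_vector, second_countable_topology} measure"
  assumes G: "G \<in> space (prob_algebra borel)" and F: "F \<in> space (prob_algebra borel)"
    and N: "N \<in> space (prob_algebra borel)" and A[measurable]: "A \<in> sets borel" and x: "0 \<le> x" "x < 1"
  shows "emeasure (rot_conv (wild_sum p G F x) N) A =
    (\<Sum>k. ennreal ((1 - x) * x ^ k) * emeasure (rot_conv (wild p G F k) N) A)"
proof -
  interpret N: prob_space N using N by (simp add: space_prob_algebra)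
  interpret A: prob_space angle by (rule prob_space_angle)
  have [measurable_cong]: "sets N = sets borel" using N by (simp add: space_prob_algebra)
  note W = wild_sum_prob_algebra[OF G F, of p x]
  have [measurable]: "(\<lambda>u. \<integral>\<^sup>+y. \<integral>\<^sup>+\<theta>. indicator A (cos \<theta> *\<^sub>R u + sin \<theta> *\<^sub>R y) \<partial>angle \<partial>N)
      \<in> borel_measurable borel"
    by measurable
  have "emeasure (rot_conv (wild_sum p G F x) N) A =
    (\<integral>\<^sup>+u. \<integral>\<^sup>+y. \<integral>\<^sup>+\<theta>. indicator A (cos \<theta> *\<^sub>R u + sin \<theta> *\<^sub>R y) \<partial>angle \<partial>N \<partial>wild_sum p G F x)"
    by (rule emeasure_rot_conv)
       (use W N in \<open>auto simp: space_prob_algebra prob_space.finite_measure\<close>)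
  also have "\<dots> = (\<Sum>k. ennreal ((1 - x) * x ^ k) *
      (\<integral>\<^sup>+u. \<integral>\<^sup>+y. \<integral>\<^sup>+\<theta>. indicator A (cos \<theta> *\<^sub>R u + sin \<theta> *\<^sub>R y) \<partial>angle \<partial>N \<partial>wild p G F k))"
    by (rule nn_integral_wild_sum[OF G F _ x]) measurable
  also have "\<dots> = (\<Sum>k. ennreal ((1 - x) * x ^ k) * emeasure (rot_conv (wild p G F k) N) A)"
    by (subst emeasure_rot_conv)
       (use N in \<open>auto simp: wild_finite_measure[OF G F] space_prob_algebra prob_space.finite_measure\<close>)
  finally show ?thesis .
qed

lemma sums_if_suminf_ennreal:
  assumes "\<And>i. 0 \<le> f i" "0 \<le> s" "ennreal s = (\<Sum>i. ennreal (f i))"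
  shows "f sums s"
proof -
  have "(\<lambda>i. ennreal (f i)) sums ennreal s"
    unfolding assms(3) by (rule summable_sums[OF summableI])
  then show ?thesis by (rule sums_ennreal[OF assms(1,2), THEN iffD1])
qed

text \<open>Here the mixture sits under the integral over the first variable, so the series has to
  be exchanged with that integral by monotone convergence.\<close>

lemma emeasure_rot_conv_wild_sum_right:
  fixes G :: "'a::{real_normed_vector, second_countable_topology} measure"
  assumes G: "G \<in> space (prob_algebra borel)" and F: "F \<in> space (prob_algebra borel)"
    and M: "M \<in> space (prob_algebra borel)" and A[measurable]: "A \<in> sets borel" and x: "0 \<le> x" "x < 1"
  shows "emeasure (rot_conv M (wild_sum p G F x)) A =
    (\<Sum>k. ennreal ((1 - x) * x ^ k) * emeasure (rot_conv M (wild p G F k)) A)"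
proof -
  interpret M: prob_space M using M by (simp add: space_prob_algebra)
  interpret A: prob_space angle by (rule prob_space_angle)
  have [measurable_cong]: "sets M = sets borel" using M by (simp add: space_prob_algebra)
  note W = wild_sum_prob_algebra[OF G F, of p x]
  have "emeasure (rot_conv M (wild_sum p G F x)) A =
    (\<integral>\<^sup>+u. \<integral>\<^sup>+y. \<integral>\<^sup>+\<theta>. indicator A (cos \<theta> *\<^sub>R u + sin \<theta> *\<^sub>R y) \<partial>angle \<partial>wild_sum p G F x \<partial>M)"
    by (rule emeasure_rot_conv)
       (use W M in \<open>auto simp: space_prob_algebra prob_space.finite_measure\<close>)
  also have "\<dots> = (\<integral>\<^sup>+u. (\<Sum>k. ennreal ((1 - x) * x ^ k) *
      (\<integral>\<^sup>+y. \<integral>\<^sup>+\<theta>. indicator A (cos \<theta> *\<^sub>R u + sin \<theta> *\<^sub>R y) \<partial>angle \<partial>wild p G F k)) \<partial>M)"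
    by (intro nn_integral_cong nn_integral_wild_sum[OF G F _ x]) measurable
  also have "\<dots> = (\<Sum>k. \<integral>\<^sup>+u. ennreal ((1 - x) * x ^ k) *
      (\<integral>\<^sup>+y. \<integral>\<^sup>+\<theta>. indicator A (cos \<theta> *\<^sub>R u + sin \<theta> *\<^sub>R y) \<partial>angle \<partial>wild p G F k) \<partial>M)"
  proof (rule nn_integral_suminf)
    fix k
    interpret W: finite_measure "wild p G F k" by (rule wild_finite_measure[OF G F])
    have [measurable_cong]: "sets (wild p G F k) = sets borel" by (rule wild_finite_measure[OF G F])
    show "(\<lambda>u. ennreal ((1 - x) * x ^ k) *
      (\<integral>\<^sup>+y. \<integral>\<^sup>+\<theta>. indicator A (cos \<theta> *\<^sub>R u + sin \<theta> *\<^sub>R y) \<partial>angle \<partial>wild p G F k)) \<in> borel_measurable M"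
      by measurable
  qed
  also have "\<dots> = (\<Sum>k. ennreal ((1 - x) * x ^ k) * emeasure (rot_conv M (wild p G F k)) A)"
  proof (rule suminf_cong)
    fix k
    interpret W: finite_measure "wild p G F k" by (rule wild_finite_measure[OF G F])
    have [measurable_cong]: "sets (wild p G F k) = sets borel" by (rule wild_finite_measure[OF G F])
    have [measurable]: "(\<lambda>u. \<integral>\<^sup>+y. \<integral>\<^sup>+\<theta>. indicator A (cos \<theta> *\<^sub>R u + sin \<theta> *\<^sub>R y) \<partial>angle \<partial>wild p G F k)
        \<in> borel_measurable M"
      by measurable
    have "emeasure (rot_conv M (wild p G F k)) A =
      (\<integral>\<^sup>+u. \<integral>\<^sup>+y. \<integral>\<^sup>+\<theta>. indicator A (cos \<theta> *\<^sub>R u + sin \<theta> *\<^sub>R y) \<partial>angle \<partial>wild p G F k \<partial>M)"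
      by (rule emeasure_rot_conv)
         (use M in \<open>auto simp: wild_finite_measure[OF G F] space_prob_algebra prob_space.finite_measure\<close>)
    then show "(\<integral>\<^sup>+u. ennreal ((1 - x) * x ^ k) *
      (\<integral>\<^sup>+y. \<integral>\<^sup>+\<theta>. indicator A (cos \<theta> *\<^sub>R u + sin \<theta> *\<^sub>R y) \<partial>angle \<partial>wild p G F k) \<partial>M)
       = ennreal ((1 - x) * x ^ k) * emeasure (rot_conv M (wild p G F k)) A"
      by (simp add: nn_integral_cmult)
  qed
  finally show ?thesis .
qed

lemma emeasure_eq_measure_prob:
  "M \<in> space (prob_algebra N) \<Longrightarrow> emeasure M A = ennreal (measure M A)"
  by (simp add: space_prob_algebra prob_space_def finite_measure.emeasure_eq_measure)

text \<open>The factor \<open>real (Suc n)\<close> is kept on the left because the product is the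
  coefficient of \<open>x ^ n\<close> in the derivative of the power series of the masses.\<close>

lemma measure_wild_Suc:
  assumes G: "G \<in> space (prob_algebra borel)" and F: "F \<in> space (prob_algebra borel)"
    and p: "0 \<le> p" "p \<le> 1" and A: "A \<in> sets borel"
  shows "real (Suc n) * measure (wild p G F (Suc n)) A = (\<Sum>k\<le>n.
     p * measure (rot_conv (wild p G F k) (wild p G F (n - k))) A
     + (1 - p) * measure (rot_conv (wild p G F k) G) A)" (is "_ = sum ?q _")
proof -
  note W = wild_prob_algebra[OF G F]
  have q: "?q k \<ge> 0" for k using p by simp
  have em: "emeasure (wild p G F n) A = ennreal (measure (wild p G F n) A)"
    "emeasure (rot_conv (wild p G F k) (wild p G F n)) A = ennreal (measure (rot_conv (wild p G F k) (wild p G F n)) A)"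
    "emeasure (rot_conv (wild p G F k) G) A = ennreal (measure (rot_conv (wild p G F k) G) A)" for k n
    by (intro emeasure_eq_measure_prob[where N = borel] W rot_conv_prob_algebra G)+
  have "emeasure (wild p G F (Suc n)) A = (\<Sum>k\<le>n.
     ennreal p * emeasure (rot_conv (wild p G F k) (wild p G F (n - k))) A
     + ennreal (1 - p) * emeasure (rot_conv (wild p G F k) G) A) / ennreal (real (Suc n))"
    using nn_integral_wild_Suc[OF G F borel_measurable_indicator[OF A] p, of n] A
    by (simp add: wild_finite_measure[OF G F] del: wild.simps of_nat_Suc)
  also have "\<dots> = (\<Sum>k\<le>n. ennreal (?q k)) / ennreal (real (Suc n))"
    unfolding em using p
    by (intro arg_cong2[where f = "(/)"] refl sum.cong) (simp add: ennreal_mult)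
  also have "\<dots> = ennreal (sum ?q {..n} / real (Suc n))"
    using q by (subst sum_ennreal) (auto intro!: divide_ennreal sum_nonneg simp del: of_nat_Suc)
  finally have "measure (wild p G F (Suc n)) A = sum ?q {..n} / real (Suc n)"
    by (rule measure_eq_emeasure_eq_ennreal[rotated]) (intro divide_nonneg_nonneg sum_nonneg q of_nat_0_le_iff)
  then show ?thesis by (simp del: of_nat_Suc wild.simps)
qed

lemma measure_wild_sum_sums:
  assumes G: "G \<in> space (prob_algebra borel)" and F: "F \<in> space (prob_algebra borel)"
    and A: "A \<in> sets borel" and x: "0 \<le> x" "x < 1"
  shows "(\<lambda>n. (1 - x) * x ^ n * measure (wild p G F n) A) sums measure (wild_sum p G F x) A"
proof -
  note W = wild_sum_prob_algebra[OF G F, of p x]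
  have sets: "sets (wild_sum p G F x) = sets borel"
    using W by (simp add: space_prob_algebra)
  have "ennreal (measure (wild_sum p G F x) A) = emeasure (wild_sum p G F x) A"
    by (rule emeasure_eq_measure_prob[OF W, symmetric])
  also have "\<dots> = (\<Sum>n. ennreal ((1 - x) * x ^ n) * emeasure (wild p G F n) A)"
    using nn_integral_wild_sum[OF G F borel_measurable_indicator[OF A] x, of p] A
    by (simp only: wild_finite_measure[OF G F] nn_integral_indicator sets)
  also have "\<dots> = (\<Sum>n. ennreal ((1 - x) * x ^ n * measure (wild p G F n) A))"
    using x by (intro suminf_cong) (simp add: emeasure_eq_measure_prob[OF wild_prob_algebra[OF G F]] ennreal_mult)
  finally show ?thesis
    using x by (intro sums_if_suminf_ennreal) auto
qed

text \<open>Bilinearity expands the collision of the Wild sum with itself into a double series. On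
  the antidiagonal \<open>k + l = n\<close> the product of the weights is
  \<open>(1 - x)^2 * x ^ n\<close>, independent of \<open>k\<close>, so the inner sum is exactly the
  Wild recursion.\<close>

lemma measure_rot_conv_wild_sum_sums:
  assumes G: "G \<in> space (prob_algebra borel)" and F: "F \<in> space (prob_algebra borel)"
    and p: "0 \<le> p" "p \<le> 1" and A: "A \<in> sets borel" and x: "0 \<le> x" "x < 1"
  shows "(\<lambda>n. (1 - x)\<^sup>2 * x ^ n * (real (Suc n) * measure (wild p G F (Suc n)) A)) sums
    (p * measure (rot_conv (wild_sum p G F x) (wild_sum p G F x)) A
     + (1 - p) * measure (rot_conv (wild_sum p G F x) G) A)" (is "_ sums ?R")
proof -
  let ?W = "wild_sum p G F x" and ?Q = "wild p G F"
  let ?w = "\<lambda>k. (1 - x) * x ^ k"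
  note Q = wild_prob_algebra[OF G F] and W = wild_sum_prob_algebra[OF G F, of p x]
  define q where "q k l = p * measure (rot_conv (?Q k) (?Q l)) A + (1 - p) * measure (rot_conv (?Q k) G) A" for k l
  have em: "emeasure (rot_conv (?Q k) (?Q n)) A = ennreal (measure (rot_conv (?Q k) (?Q n)) A)"
    "emeasure (rot_conv (?Q k) G) A = ennreal (measure (rot_conv (?Q k) G) A)"
    "emeasure (rot_conv ?W ?W) A = ennreal (measure (rot_conv ?W ?W) A)"
    "emeasure (rot_conv ?W G) A = ennreal (measure (rot_conv ?W G) A)" for k n
    by (intro emeasure_eq_measure_prob[where N = borel] Q W rot_conv_prob_algebra G)+
  have w0: "?w k \<ge> 0" for k using x by simp
  have q0: "q k l \<ge> 0" for k l using p by (simp add: q_def)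
  \<comment> \<open>The thermostat term is only a single series over \<open>k\<close>. Multiplying
    it by the total weight 1 of a dummy index \<open>l\<close> lets it join the double
    series.\<close>
  have "?w sums 1"
    using sums_mult[OF geometric_sums[of x], of "1 - x"] x by simp
  then have w1: "(\<Sum>l. ennreal (?w l)) = 1"
    unfolding ennreal_1[symmetric] by (rule suminf_ennreal_eq[OF w0])
  have "ennreal ?R = ennreal p * emeasure (rot_conv ?W ?W) A + ennreal (1 - p) * emeasure (rot_conv ?W G) A"
    unfolding em using p by (simp add: ennreal_mult)
  also have "emeasure (rot_conv ?W ?W) A = (\<Sum>k. ennreal (?w k) * (\<Sum>l. ennreal (?w l) * emeasure (rot_conv (?Q k) (?Q l)) A))"
    unfolding emeasure_rot_conv_wild_sum_left[OF G F W A x] emeasure_rot_conv_wild_sum_right[OF G F Q A x] ..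
  also have "emeasure (rot_conv ?W G) A = (\<Sum>k. ennreal (?w k) * (\<Sum>l. ennreal (?w l) * emeasure (rot_conv (?Q k) G) A))"
    using emeasure_rot_conv_wild_sum_left[OF G F G A x] by (simp add: w1)
  also have "ennreal p * (\<Sum>k. ennreal (?w k) * (\<Sum>l. ennreal (?w l) * emeasure (rot_conv (?Q k) (?Q l)) A))
      + ennreal (1 - p) * (\<Sum>k. ennreal (?w k) * (\<Sum>l. ennreal (?w l) * emeasure (rot_conv (?Q k) G) A))
    = (\<Sum>k. \<Sum>l. ennreal (?w k) * (ennreal (?w l) *
        (ennreal p * emeasure (rot_conv (?Q k) (?Q l)) A + ennreal (1 - p) * emeasure (rot_conv (?Q k) G) A)))"
    by (simp only: ennreal_suminf_cmult[symmetric] suminf_add[OF summableI summableI] distrib_left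
        mult.left_commute[of "ennreal p"] mult.left_commute[of "ennreal (1 - p)"])
  also have "\<dots> = (\<Sum>k. \<Sum>l. ennreal (?w k * ?w l * q k l))"
    unfolding em using p x
    by (simp add: ennreal_mult q_def mult.assoc)
  also have "\<dots> = (\<Sum>n. \<Sum>k\<le>n. ennreal (?w k * ?w (n - k) * q k (n - k)))"
    by (rule suminf_antidiagonal)
  also have "\<dots> = (\<Sum>n. ennreal ((1 - x)\<^sup>2 * x ^ n * (real (Suc n) * measure (?Q (Suc n)) A)))"
  proof (rule suminf_cong)
    fix n
    have "(\<Sum>k\<le>n. ennreal (?w k * ?w (n - k) * q k (n - k))) = ennreal (\<Sum>k\<le>n. ?w k * ?w (n - k) * q k (n - k))"
      using w0 q0 by (intro sum_ennreal) (meson mult_nonneg_nonneg)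
    also have "(\<Sum>k\<le>n. ?w k * ?w (n - k) * q k (n - k)) = (\<Sum>k\<le>n. (1 - x)\<^sup>2 * x ^ n * q k (n - k))"
    proof (rule sum.cong[OF refl])
      fix k assume "k \<in> {..n}"
      then have "x ^ n = x ^ k * x ^ (n - k)" by (simp flip: power_add)
      then show "?w k * ?w (n - k) * q k (n - k) = (1 - x)\<^sup>2 * x ^ n * q k (n - k)"
        by (simp add: power2_eq_square)
    qed
    also have "\<dots> = (1 - x)\<^sup>2 * x ^ n * (real (Suc n) * measure (?Q (Suc n)) A)"
      unfolding measure_wild_Suc[OF G F p A] q_def by (rule sum_distrib_left[symmetric])
    finally show "(\<Sum>k\<le>n. ennreal (?w k * ?w (n - k) * q k (n - k))) =
        ennreal ((1 - x)\<^sup>2 * x ^ n * (real (Suc n) * measure (?Q (Suc n)) A))" .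
  qed
  finally show ?thesis
    using x p by (intro sums_if_suminf_ennreal mult_nonneg_nonneg add_nonneg_nonneg) auto
qed

text \<open>The mass of \<open>A\<close> is \<open>exp (- a * s) * P (X s)\<close> for the power
  series \<open>P\<close> of the masses of the Wild terms. The product rule yields the loss term
  from the exponential, and \<open>(1 - x)^2 * P' x\<close> is the gain term by the preceding series
  identity, since \<open>X\<close> has derivative \<open>a * (1 - X s)\<close>.\<close>

lemma measure_wild_sum_has_derivative:
  assumes G: "G \<in> space (prob_algebra borel)" and F: "F \<in> space (prob_algebra borel)"
    and p: "0 \<le> p" "p \<le> 1" and A: "A \<in> sets borel" and a: "a > 0" and t: "t \<ge> 0"
  defines "W \<equiv> \<lambda>s. wild_sum p G F (1 - exp (- a * s))"
  shows "((\<lambda>s. measure (W s) A) has_real_derivative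
    a * (p * measure (rot_conv (W t) (W t)) A + (1 - p) * measure (rot_conv (W t) G) A - measure (W t) A))
    (at t within {0..})"
proof -
  define m where "m n = measure (wild p G F n) A" for n
  define P where "P x = (\<Sum>n. m n * x ^ n)" for x
  define X where "X s = 1 - exp (- a * s)" for s
  have X: "0 \<le> X s" "X s < 1" if "s \<ge> 0" for s
    using a that by (auto simp: X_def)
  have m1: "\<bar>m n\<bar> \<le> 1" for n
  proof -
    have "prob_space (wild p G F n)"
      using wild_prob_algebra[OF G F] by (simp add: space_prob_algebra)
    then show ?thesis by (simp add: m_def prob_space.prob_le_1)
  qed
  have sm: "summable (\<lambda>n. m n * x ^ n)" if "0 \<le> x" "x < 1" for x
  proof (rule summable_comparison_test')
    show "summable (\<lambda>n. x ^ n)" using that by simp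
    show "norm (m n * x ^ n) \<le> x ^ n" for n
      using that m1[of n] by (simp add: abs_mult mult_left_le_one_le)
  qed
  have DP: "(P has_real_derivative (\<Sum>n. diffs m n * x ^ n)) (at x)" if x: "0 \<le> x" "x < 1" for x
    unfolding P_def
  proof (rule termdiffs_strong)
    \<comment> \<open>Termwise differentiation requires convergence at a point of larger modulus;
      the midpoint of \<open>x\<close> and 1 is one, as the coefficients are bounded by 1.\<close>
    show "summable (\<lambda>n. m n * ((1 + x) / 2) ^ n)"
      using x by (intro sm) auto
    show "norm x < norm ((1 + x) / 2)"
      using x by simp
  qed
  have WP: "measure (W s) A = exp (- a * s) * P (X s)" if "s \<ge> 0" for s
  proof -
    have 1: "(\<lambda>n. (1 - X s) * (m n * X s ^ n)) sums measure (W s) A"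
      using measure_wild_sum_sums[OF G F A X[OF that], of p]
      unfolding W_def X_def[symmetric] m_def[symmetric] by (simp only: mult.assoc mult.commute[of "m _"])
    have 2: "(\<lambda>n. (1 - X s) * (m n * X s ^ n)) sums ((1 - X s) * P (X s))"
      unfolding P_def by (rule sums_mult[OF summable_sums[OF sm[OF X[OF that]]]])
    show ?thesis
      using sums_unique2[OF 1 2] by (simp add: X_def)
  qed
  have R: "(exp (- a * t))\<^sup>2 * (\<Sum>n. diffs m n * X t ^ n) =
      p * measure (rot_conv (W t) (W t)) A + (1 - p) * measure (rot_conv (W t) G) A" (is "_ = ?R")
  proof -
    have coeff: "(1 - X t)\<^sup>2 * X t ^ n * (real (Suc n) * m (Suc n)) = (exp (- a * t))\<^sup>2 * (diffs m n * X t ^ n)" for n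
      unfolding X_def diffs_def by (simp only: diff_diff_eq2 add_diff_cancel_left' mult_ac)
    have 1: "(\<lambda>n. (exp (- a * t))\<^sup>2 * (diffs m n * X t ^ n)) sums ?R"
      using measure_rot_conv_wild_sum_sums[OF G F p A X[OF t]]
      unfolding W_def X_def[symmetric] m_def[symmetric] coeff .
    have 2: "summable (\<lambda>n. diffs m n * X t ^ n)"
      by (rule summable_mult_D[OF sums_summable[OF 1]]) simp
    show ?thesis
      by (rule trans[OF suminf_mult[OF 2, symmetric] sums_unique[OF 1, symmetric]])
  qed
  have E: "((\<lambda>s. exp (- a * s)) has_real_derivative - a * exp (- a * t)) (at t)"
    by (auto intro!: derivative_eq_intros)
  have "(X has_real_derivative a * exp (- a * t)) (at t)"
    unfolding X_def by (auto intro!: derivative_eq_intros)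
  then have PX: "((\<lambda>s. P (X s)) has_real_derivative (\<Sum>n. diffs m n * X t ^ n) * (a * exp (- a * t))) (at t)"
    by (rule DERIV_chain2[where f = P and g = X, OF DP[OF X[OF t]]])
  have "(- a * e) * y + z * (a * e) * e = a * (e\<^sup>2 * z - e * y)" for e y z
    by (simp add: algebra_simps power2_eq_square)
  then have "((\<lambda>s. exp (- a * s) * P (X s)) has_real_derivative a * (?R - measure (W t) A)) (at t)"
    using DERIV_mult[OF E PX] unfolding R[symmetric] WP[OF t] by simp
  \<comment> \<open>The closed form agrees with the mass only for nonnegative times, hence the
    passage to a one-sided derivative before the substitution.\<close>
  then have "((\<lambda>s. exp (- a * s) * P (X s)) has_real_derivative a * (?R - measure (W t) A)) (at t within {0..})"
    by (rule has_field_derivative_at_within)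
  then show ?thesis
    by (rule has_field_derivative_transform_within[OF _ zero_less_one]) (simp_all add: t WP)
qed

lemma measure_wild_sum_0:
  assumes G: "G \<in> space (prob_algebra borel)" and F: "F \<in> space (prob_algebra borel)"
    and A: "A \<in> sets borel"
  shows "measure (wild_sum p G F 0) A = measure F A"
proof -
  \<comment> \<open>As \<open>0 ^ 0 = 1\<close>, only the term \<open>n = 0\<close> contributes, and
    it is \<open>F\<close>.\<close>
  have "(\<lambda>n. measure (wild p G F n) A * 0 ^ n) sums measure (wild_sum p G F 0) A"
    using measure_wild_sum_sums[OF G F A, of 0] by (simp add: mult.commute)
  then show ?thesis
    using powser_sums_zero[of "\<lambda>n. measure (wild p G F n) A"] by (simp add: sums_unique2)
qed

section \<open>Total variation estimates\<close>

lemma diff_measure_le_tv_dist: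
  assumes M: "finite_borel_measure M" and N: "finite_borel_measure N" and A: "A \<in> sets borel"
  shows "\<bar>measure M A - measure N A\<bar> \<le> tv_dist M N"
proof -
  interpret M: finite_borel_measure M by fact
  interpret N: finite_borel_measure N by fact
  note [simp] = M.M_is_borel N.M_is_borel
  let ?PP = "{P. finite P \<and> partition_on (UNIV :: real set) P \<and> P \<subseteq> sets borel}"
  let ?g = "\<lambda>P. \<Sum>A\<in>P. \<bar>measure M A - measure N A\<bar>"
  \<comment> \<open>The blocks of a partition are nonempty, so the empty set is removed to cover
    \<open>A\<close> empty or the whole line.\<close>
  let ?P = "{A, - A} - {{}}"
  have "?P \<in> ?PP"
    using A by (auto simp: partition_on_def disjoint_def)
  \<comment> \<open>A supremum of reals dominates its terms only if they are bounded; here the two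
    total masses bound them.\<close>
  moreover have "bdd_above (?g ` ?PP)"
  proof (rule bdd_aboveI2)
    fix P assume P: "P \<in> ?PP"
    have "?g P \<le> (\<Sum>A\<in>P. measure M A + measure N A)"
      by (intro sum_mono) (smt (verit) measure_nonneg)
    also have "\<dots> = measure M (\<Union>P) + measure N (\<Union>P)"
      using P M.finite_measure_finite_Union[of P "\<lambda>A. A"] N.finite_measure_finite_Union[of P "\<lambda>A. A"]
      by (auto simp: sum.distrib partition_on_def disjoint_def disjoint_family_on_def)
    finally show "?g P \<le> measure M UNIV + measure N UNIV"
      using P by (simp add: partition_on_def)
  qed
  ultimately have "?g ?P \<le> tv_dist M N"
    unfolding tv_dist_def by (rule cSUP_upper)
  moreover have "\<bar>measure M A - measure N A\<bar> \<le> ?g ?P"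
  proof (cases "A = {}")
    case False
    then show ?thesis by (intro member_le_sum[of A ?P]) auto
  qed (simp add: sum_nonneg)
  ultimately show ?thesis by simp
qed

lemma measure_pair_section1:
  assumes M: "finite_measure M" and P: "finite_measure P" and C: "C \<in> sets (M \<Otimes>\<^sub>M P)"
  shows "integrable P (\<lambda>q. measure M ((\<lambda>x. (x, q)) -` C))"
    "measure (M \<Otimes>\<^sub>M P) C = (LINT q|P. measure M ((\<lambda>x. (x, q)) -` C))"
proof -
  interpret M: finite_measure M by fact
  interpret P: finite_measure P by fact
  interpret MP: pair_sigma_finite M P ..
  have [measurable]: "(\<lambda>q. measure M ((\<lambda>x. (x, q)) -` C)) \<in> borel_measurable P"
    unfolding measure_def using MP.measurable_emeasure_Pair2[OF C] by measurable
  show I: "integrable P (\<lambda>q. measure M ((\<lambda>x. (x, q)) -` C))"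
    by (rule P.integrable_const_bound[where B = "measure M (space M)"]) (auto simp: M.bounded_measure)
  show "measure (M \<Otimes>\<^sub>M P) C = (LINT q|P. measure M ((\<lambda>x. (x, q)) -` C))"
  proof (rule measure_eq_emeasure_eq_ennreal)
    have "emeasure (M \<Otimes>\<^sub>M P) C = (\<integral>\<^sup>+q. ennreal (measure M ((\<lambda>x. (x, q)) -` C)) \<partial>P)"
      by (simp add: MP.emeasure_pair_measure_alt2[OF C] M.emeasure_eq_measure)
    also have "\<dots> = ennreal (LINT q|P. measure M ((\<lambda>x. (x, q)) -` C))"
      by (rule nn_integral_eq_integral[OF I]) auto
    finally show "emeasure (M \<Otimes>\<^sub>M P) C = ennreal (LINT q|P. measure M ((\<lambda>x. (x, q)) -` C))" .
  qed (simp add: integral_nonneg)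
qed

lemma measure_pair_section2:
  assumes M: "finite_measure M" and P: "finite_measure P" and C: "C \<in> sets (M \<Otimes>\<^sub>M P)"
  shows "integrable M (\<lambda>x. measure P (Pair x -` C))"
    "measure (M \<Otimes>\<^sub>M P) C = (LINT x|M. measure P (Pair x -` C))"
proof -
  interpret M: finite_measure M by fact
  interpret P: finite_measure P by fact
  have [measurable]: "(\<lambda>x. measure P (Pair x -` C)) \<in> borel_measurable M"
    unfolding measure_def using P.measurable_emeasure_Pair[OF C] by measurable
  show I: "integrable M (\<lambda>x. measure P (Pair x -` C))"
    by (rule M.integrable_const_bound[where B = "measure P (space P)"]) (auto simp: P.bounded_measure)
  show "measure (M \<Otimes>\<^sub>M P) C = (LINT x|M. measure P (Pair x -` C))"
  proof (rule measure_eq_emeasure_eq_ennreal)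
    have "emeasure (M \<Otimes>\<^sub>M P) C = (\<integral>\<^sup>+x. ennreal (measure P (Pair x -` C)) \<partial>M)"
      by (simp add: P.emeasure_pair_measure_alt[OF C] P.emeasure_eq_measure)
    also have "\<dots> = ennreal (LINT x|M. measure P (Pair x -` C))"
      by (rule nn_integral_eq_integral[OF I]) auto
    finally show "emeasure (M \<Otimes>\<^sub>M P) C = ennreal (LINT x|M. measure P (Pair x -` C))" .
  qed (simp add: integral_nonneg)
qed

lemma abs_diff_integral_le:
  fixes u v :: "'a \<Rightarrow> real"
  assumes "finite_measure P" "integrable P u" "integrable P v" "\<And>x. \<bar>u x - v x\<bar> \<le> e"
  shows "\<bar>integral\<^sup>L P u - integral\<^sup>L P v\<bar> \<le> e * measure P (space P)"
proof -
  interpret finite_measure P by fact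
  have "\<bar>integral\<^sup>L P u - integral\<^sup>L P v\<bar> = \<bar>LINT x|P. u x - v x\<bar>"
    using assms by simp
  also have "\<dots> \<le> (LINT x|P. \<bar>u x - v x\<bar>)"
    by (rule integral_abs_bound)
  also have "\<dots> \<le> (LINT x|P. e)"
    using assms by (intro integral_mono) auto
  finally show ?thesis by (simp add: mult.commute)
qed

text \<open>Each slice of \<open>C\<close> at a fixed second coordinate is measurable for the first
  factor, so its masses under \<open>M\<close> and \<open>M'\<close> differ by at most
  \<open>e\<close>; integrating over the slices multiplies this by the mass of
  \<open>P\<close>.\<close>

lemma measure_pair_lipschitz1:
  assumes "finite_measure M" "finite_measure M'" "finite_measure P" and s: "sets M = sets M'"
    and C: "C \<in> sets (M \<Otimes>\<^sub>M P)" and e: "\<And>A. A \<in> sets M \<Longrightarrow> \<bar>measure M A - measure M' A\<bar> \<le> e"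
  shows "\<bar>measure (M \<Otimes>\<^sub>M P) C - measure (M' \<Otimes>\<^sub>M P) C\<bar> \<le> e * measure P (space P)"
proof -
  have C': "C \<in> sets (M' \<Otimes>\<^sub>M P)"
    using C sets_pair_measure_cong[OF s refl, of P] by simp
  show ?thesis
    unfolding measure_pair_section1(2)[OF assms(1,3) C] measure_pair_section1(2)[OF assms(2,3) C']
    by (intro abs_diff_integral_le measure_pair_section1 assms C' e sets_Pair2[OF C])
qed

lemma measure_pair_lipschitz2:
  assumes "finite_measure M" "finite_measure P" "finite_measure P'" and s: "sets P = sets P'"
    and C: "C \<in> sets (M \<Otimes>\<^sub>M P)" and e: "\<And>A. A \<in> sets P \<Longrightarrow> \<bar>measure P A - measure P' A\<bar> \<le> e"
  shows "\<bar>measure (M \<Otimes>\<^sub>M P) C - measure (M \<Otimes>\<^sub>M P') C\<bar> \<le> e * measure M (space M)"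
proof -
  have C': "C \<in> sets (M \<Otimes>\<^sub>M P')"
    using C sets_pair_measure_cong[OF refl s, of M] by simp
  show ?thesis
    unfolding measure_pair_section2(2)[OF assms(1,2) C] measure_pair_section2(2)[OF assms(1,3) C']
    by (intro abs_diff_integral_le measure_pair_section2 assms C' e sets_Pair1[OF C])
qed

lemma measure_rot_conv:
  fixes M N :: "'a::{real_normed_vector, second_countable_topology} measure"
  assumes s: "sets M = sets borel" "sets N = sets borel" and A: "A \<in> sets borel"
  defines "C \<equiv> {(x, y, \<theta>). cos \<theta> *\<^sub>R x + sin \<theta> *\<^sub>R y \<in> A}"
  shows "C \<in> sets (M \<Otimes>\<^sub>M (N \<Otimes>\<^sub>M angle))" "measure (rot_conv M N) A = measure (M \<Otimes>\<^sub>M (N \<Otimes>\<^sub>M angle)) C"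
proof -
  have sp: "space M = UNIV" "space N = UNIV"
    using s[THEN sets_eq_imp_space_eq] by auto
  have C: "(\<lambda>(x, y, \<theta>). cos \<theta> *\<^sub>R x + sin \<theta> *\<^sub>R y) -` A \<inter> space (M \<Otimes>\<^sub>M (N \<Otimes>\<^sub>M angle)) = C"
    by (auto simp: C_def space_pair_measure sp)
  show "C \<in> sets (M \<Otimes>\<^sub>M (N \<Otimes>\<^sub>M angle))"
    using measurable_sets[OF rotation_measurable[OF s] A] unfolding C .
  show "measure (rot_conv M N) A = measure (M \<Otimes>\<^sub>M (N \<Otimes>\<^sub>M angle)) C"
    using measure_distr[OF rotation_measurable[OF s] A] unfolding C rot_conv_def .
qed

text \<open>One factor is changed at a time, passing through \<open>rot_conv M' N\<close>. The angle
  has mass 1 and contributes no factor.\<close>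

lemma measure_rot_conv_lipschitz:
  fixes M M' N N' :: "'a::{real_normed_vector, second_countable_topology} measure"
  assumes fin: "finite_measure M" "finite_measure M'" "finite_measure N" "finite_measure N'"
    and s: "sets M = sets borel" "sets M' = sets borel" "sets N = sets borel" "sets N' = sets borel"
    and A: "A \<in> sets borel"
    and d: "\<And>B. B \<in> sets borel \<Longrightarrow> \<bar>measure M B - measure M' B\<bar> \<le> d"
    and e: "\<And>B. B \<in> sets borel \<Longrightarrow> \<bar>measure N B - measure N' B\<bar> \<le> e"
  shows "\<bar>measure (rot_conv M N) A - measure (rot_conv M' N') A\<bar> \<le> d * measure N UNIV + e * measure M' UNIV"
proof -
  interpret A: prob_space angle by (rule prob_space_angle)
  interpret N: finite_measure N by fact
  interpret N': finite_measure N' by fact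
  have sp: "space M = UNIV" "space M' = UNIV" "space N = UNIV" "space N' = UNIV"
    using s[THEN sets_eq_imp_space_eq] by auto
  have finP: "finite_measure (N \<Otimes>\<^sub>M angle)" "finite_measure (N' \<Otimes>\<^sub>M angle)"
    by (intro finite_measure_pair_measure fin A.finite_measure_axioms)+
  have massP: "measure (N \<Otimes>\<^sub>M angle) (space (N \<Otimes>\<^sub>M angle)) = measure N UNIV"
  proof -
    have "emeasure (N \<Otimes>\<^sub>M angle) (space N \<times> space angle) = emeasure N (space N)"
      by (subst A.emeasure_pair_measure_Times) (simp_all add: A.emeasure_space_1[simplified])
    then show ?thesis by (simp add: measure_def space_pair_measure sp)
  qed
  have "\<bar>measure (rot_conv M N) A - measure (rot_conv M' N) A\<bar> \<le> d * measure N UNIV"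
    unfolding measure_rot_conv(2)[OF s(1,3) A] measure_rot_conv(2)[OF s(2,3) A] massP[symmetric]
    by (rule measure_pair_lipschitz1[OF fin(1,2) finP(1) _ measure_rot_conv(1)[OF s(1,3) A]]) (auto simp: s intro: d)
  moreover have "\<bar>measure (rot_conv M' N) A - measure (rot_conv M' N') A\<bar> \<le> e * measure M' UNIV"
    unfolding measure_rot_conv(2)[OF s(2,3) A] measure_rot_conv(2)[OF s(2,4) A] sp(2)[symmetric]
  proof (rule measure_pair_lipschitz2[OF fin(2) finP _ measure_rot_conv(1)[OF s(2,3) A]])
    show "sets (N \<Otimes>\<^sub>M angle) = sets (N' \<Otimes>\<^sub>M angle)"
      by (intro sets_pair_measure_cong) (auto simp: s)
    fix B assume B: "B \<in> sets (N \<Otimes>\<^sub>M angle)"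
    show "\<bar>measure (N \<Otimes>\<^sub>M angle) B - measure (N' \<Otimes>\<^sub>M angle) B\<bar> \<le> e"
      using measure_pair_lipschitz1[OF fin(3,4) A.finite_measure_axioms _ B, of e] s e A.prob_space by simp
  qed
  ultimately show ?thesis by linarith
qed

section \<open>Uniqueness of weak solutions\<close>

lemma finite_borel_measure_finite:
  assumes "finite_borel_measure M"
  shows "finite_measure M" "sets M = sets borel"
proof -
  interpret finite_borel_measure M by fact
  show "finite_measure M" "sets M = sets borel" by (rule finite_measure_axioms, rule M_is_borel)
qed

lemma finite_borel_measure_prob_algebra:
  fixes M :: "real measure"
  assumes "M \<in> space (prob_algebra borel)"
  shows "finite_borel_measure M"
  using assms
  by (simp add: space_prob_algebra finite_borel_measure_def finite_borel_measure_axioms_def prob_space.finite_measure)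

lemma real_distribution_prob_algebra:
  "real_distribution M \<Longrightarrow> M \<in> space (prob_algebra borel)"
  by (auto simp: space_prob_algebra real_distribution_def real_distribution_axioms_def)

definition kac_rhs :: "real \<Rightarrow> real \<Rightarrow> 'a::{real_normed_vector, second_countable_topology} measure
    \<Rightarrow> 'a measure \<Rightarrow> 'a set \<Rightarrow> real" where
  "kac_rhs lam mu G M A = 2 * lam * (measure (rot_conv M M) A - measure M A)
     + mu * (measure (rot_conv M G) A - measure M A)"

text \<open>The gain term is quadratic, hence Lipschitz only on measures of bounded mass:
  \<open>2 * K\<close> comes from changing its two arguments in turn and \<open>+ 1\<close> from the
  loss. In the thermostat part gain and loss contribute 1 each because \<open>G\<close> has mass
  1.\<close>

lemma kac_rhs_lipschitz:
  fixes M N G :: "'a::{real_normed_vector, second_countable_topology} measure"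
  assumes "lam \<ge> 0" "mu \<ge> 0" and G: "G \<in> space (prob_algebra borel)"
    and fin: "finite_measure M" "finite_measure N" and s: "sets M = sets borel" "sets N = sets borel"
    and K: "measure M UNIV \<le> K" "measure N UNIV \<le> K" and A: "A \<in> sets borel"
    and d: "\<And>B. B \<in> sets borel \<Longrightarrow> \<bar>measure M B - measure N B\<bar> \<le> d"
  shows "\<bar>kac_rhs lam mu G M A - kac_rhs lam mu G N A\<bar> \<le> (2 * lam * (2 * K + 1) + mu * 2) * d"
proof -
  have G': "finite_measure G" "sets G = sets borel" "measure G UNIV = 1"
    using G prob_space.prob_space[of G] by (auto simp: space_prob_algebra prob_space.finite_measure
        dest: sets_eq_imp_space_eq)
  have d0: "d \<ge> 0" using d[OF A] by linarith
  have "\<bar>measure (rot_conv M M) A - measure (rot_conv N N) A\<bar> \<le> d * measure M UNIV + d * measure N UNIV"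
    by (intro measure_rot_conv_lipschitz fin s A d)
  also have "\<dots> \<le> d * K + d * K"
    by (intro add_mono mult_left_mono K d0)
  finally have 1: "\<bar>measure (rot_conv M M) A - measure (rot_conv N N) A\<bar> \<le> 2 * K * d"
    by simp
  have 2: "\<bar>measure (rot_conv M G) A - measure (rot_conv N G) A\<bar> \<le> d"
    using measure_rot_conv_lipschitz[OF fin G'(1,1) s G'(2,2) A d, of 0] by (simp add: G')
  have "\<bar>kac_rhs lam mu G M A - kac_rhs lam mu G N A\<bar> =
    \<bar>2 * lam * ((measure (rot_conv M M) A - measure (rot_conv N N) A) - (measure M A - measure N A))
     + mu * ((measure (rot_conv M G) A - measure (rot_conv N G) A) - (measure M A - measure N A))\<bar>"
    by (simp add: kac_rhs_def algebra_simps)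
  also have "\<dots> \<le> \<bar>2 * lam * ((measure (rot_conv M M) A - measure (rot_conv N N) A) - (measure M A - measure N A))\<bar>
     + \<bar>mu * ((measure (rot_conv M G) A - measure (rot_conv N G) A) - (measure M A - measure N A))\<bar>"
    by (rule abs_triangle_ineq)
  also have "\<dots> \<le> 2 * lam * (2 * K * d + d) + mu * (d + d)"
    unfolding abs_mult using assms(1,2) 1 2 d[OF A]
    by (intro add_mono mult_mono) (auto intro: order_trans[OF abs_triangle_ineq4])
  also have "\<dots> = (2 * lam * (2 * K + 1) + mu * 2) * d"
    by (simp add: algebra_simps)
  finally show ?thesis .
qed

section \<open>Weak solutions as differentiable functions of time\<close>

lemma weak_solutionD:
  assumes "weak_solution lam mu T f\<^sub>0 f" "t \<ge> 0"
  shows "finite_borel_measure (f t)" "((\<lambda>s. tv_dist (f s) (f t)) \<longlongrightarrow> 0) (at t within {0..})"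
    "A \<in> sets borel \<Longrightarrow> measure (f t) A = measure f\<^sub>0 A +
          (LINT s:{0..t}|lborel.
             2 * lam * (measure (collision (f s) (f s)) A - measure (f s) A)
             + mu * (measure (collision (f s) (gaussian T)) A - measure (f s) A))"
  using assms unfolding weak_solution_def by blast+

lemma weak_solution_integral_eq:
  assumes w: "weak_solution lam mu T f\<^sub>0 f" and G: "gaussian T \<in> space (prob_algebra borel)"
    and "t \<ge> 0" "A \<in> sets borel"
  shows "measure (f t) A = measure f\<^sub>0 A + (LINT s:{0..t}|lborel. kac_rhs lam mu (gaussian T) (f s) A)"
proof -
  have "(LINT s:{0..t}|lborel. 2 * lam * (measure (collision (f s) (f s)) A - measure (f s) A)
             + mu * (measure (collision (f s) (gaussian T)) A - measure (f s) A))
      = (LINT s:{0..t}|lborel. kac_rhs lam mu (gaussian T) (f s) A)"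
    using weak_solutionD(1)[OF w] finite_borel_measure_prob_algebra[OF G]
    by (intro set_lebesgue_integral_cong) (auto simp: kac_rhs_def collision_eq_rot_conv)
  then show ?thesis
    using weak_solutionD(3)[OF w assms(3,4)] by simp
qed

text \<open>The definition does not provide mass 1, so the bound comes from continuity of the total
  mass on a compact interval. Asking for \<open>K \<ge> 1\<close> makes the same constant serve the
  Wild sum.\<close>

lemma weak_solution_mass_bounded:
  assumes w: "weak_solution lam mu T f\<^sub>0 f"
  obtains K where "K \<ge> 1" "\<And>s. s \<in> {0..t} \<Longrightarrow> measure (f s) UNIV \<le> K"
proof -
  have "continuous_on {0..t} (\<lambda>s. measure (f s) UNIV)"
    unfolding continuous_on_def
  proof (intro ballI)
    fix s assume s: "s \<in> {0..t}"
    have "((\<lambda>u. tv_dist (f u) (f s)) \<longlongrightarrow> 0) (at s within {0..t})"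
      by (rule tendsto_within_subset[OF weak_solutionD(2)[OF w]]) (use s in auto)
    then have "((\<lambda>u. measure (f u) UNIV - measure (f s) UNIV) \<longlongrightarrow> 0) (at s within {0..t})"
    proof (rule Lim_null_comparison[rotated])
      show "\<forall>\<^sub>F u in at s within {0..t}. norm (measure (f u) UNIV - measure (f s) UNIV) \<le> tv_dist (f u) (f s)"
        unfolding eventually_at_filter real_norm_def using s
        by (auto intro!: always_eventually diff_measure_le_tv_dist weak_solutionD(1)[OF w])
    qed
    then show "((\<lambda>u. measure (f u) UNIV) \<longlongrightarrow> measure (f s) UNIV) (at s within {0..t})"
      by (simp add: LIM_zero_iff)
  qed
  then have "compact ((\<lambda>s. measure (f s) UNIV) ` {0..t})"
    by (rule compact_continuous_image) simp
  then have "bounded ((\<lambda>s. measure (f s) UNIV) ` {0..t})"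
    by (rule compact_imp_bounded)
  then obtain B where B: "\<forall>x\<in>(\<lambda>s. measure (f s) UNIV) ` {0..t}. norm x \<le> B"
    unfolding bounded_iff by blast
  have "measure (f s) UNIV \<le> max 1 B" if "s \<in> {0..t}" for s
    using bspec[OF B imageI[OF that]] by simp
  then show ?thesis
    using that[of "max 1 B"] by simp
qed

text \<open>Continuity in total variation meets the Lipschitz bound on measures of mass at most
  \<open>K\<close>. A continuous integrand is what allows the integral equation to be
  differentiated.\<close>

lemma weak_solution_kac_rhs_continuous:
  assumes w: "weak_solution lam mu T f\<^sub>0 f" and lm: "lam \<ge> 0" "mu \<ge> 0"
    and G: "gaussian T \<in> space (prob_algebra borel)" and A: "A \<in> sets borel"
  shows "continuous_on {0..t} (\<lambda>s. kac_rhs lam mu (gaussian T) (f s) A)"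
  unfolding continuous_on_def
proof (intro ballI)
  fix s assume s: "s \<in> {0..t}"
  obtain K where K: "\<And>s. s \<in> {0..t} \<Longrightarrow> measure (f s) UNIV \<le> K"
    using weak_solution_mass_bounded[OF w] by blast
  have fb: "finite_borel_measure (f u)" if "u \<in> {0..t}" for u
    using weak_solutionD(1)[OF w] that by simp
  have "((\<lambda>u. tv_dist (f u) (f s)) \<longlongrightarrow> 0) (at s within {0..t})"
    by (rule tendsto_within_subset[OF weak_solutionD(2)[OF w]]) (use s in auto)
  then have "((\<lambda>u. (2 * lam * (2 * K + 1) + mu * 2) * tv_dist (f u) (f s)) \<longlongrightarrow> 0) (at s within {0..t})"
    by (rule tendsto_mult_right_zero)
  then have "((\<lambda>u. kac_rhs lam mu (gaussian T) (f u) A - kac_rhs lam mu (gaussian T) (f s) A) \<longlongrightarrow> 0) (at s within {0..t})"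
  proof (rule Lim_null_comparison[rotated])
    have "norm (kac_rhs lam mu (gaussian T) (f u) A - kac_rhs lam mu (gaussian T) (f s) A)
        \<le> (2 * lam * (2 * K + 1) + mu * 2) * tv_dist (f u) (f s)" if "u \<in> {0..t}" for u
      unfolding real_norm_def
      by (intro kac_rhs_lipschitz lm G A K that s finite_borel_measure_finite fb diff_measure_le_tv_dist)
    then show "\<forall>\<^sub>F u in at s within {0..t}. norm (kac_rhs lam mu (gaussian T) (f u) A - kac_rhs lam mu (gaussian T) (f s) A)
        \<le> (2 * lam * (2 * K + 1) + mu * 2) * tv_dist (f u) (f s)"
      unfolding eventually_at_filter by (auto intro!: always_eventually)
  qed
  then show "((\<lambda>u. kac_rhs lam mu (gaussian T) (f u) A) \<longlongrightarrow> kac_rhs lam mu (gaussian T) (f s) A) (at s within {0..t})"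
    by (simp add: LIM_zero_iff)
qed

text \<open>Fundamental theorem of calculus, after the Lebesgue integral over \<open>{0..u}\<close>
  is rewritten as a gauge integral.\<close>

lemma weak_solution_has_derivative:
  assumes w: "weak_solution lam mu T f\<^sub>0 f" and lm: "lam \<ge> 0" "mu \<ge> 0"
    and G: "gaussian T \<in> space (prob_algebra borel)" and A: "A \<in> sets borel" and s: "s \<in> {0..t}"
  shows "((\<lambda>s. measure (f s) A) has_real_derivative kac_rhs lam mu (gaussian T) (f s) A) (at s within {0..t})"
proof -
  let ?h = "\<lambda>s. kac_rhs lam mu (gaussian T) (f s) A"
  have cont: "continuous_on {0..t} ?h" for t
    by (rule weak_solution_kac_rhs_continuous[OF w lm G A])
  have "((\<lambda>u. measure f\<^sub>0 A + integral {0..u} ?h) has_real_derivative 0 + ?h s) (at s within {0..t})"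
    by (rule DERIV_add[OF DERIV_const integral_has_real_derivative[OF cont s]])
  then have D: "((\<lambda>u. measure f\<^sub>0 A + integral {0..u} ?h) has_real_derivative ?h s) (at s within {0..t})"
    by simp
  have "measure (f u) A = measure f\<^sub>0 A + integral {0..u} ?h" if "u \<in> {0..t}" for u
    using weak_solution_integral_eq[OF w G _ A, of u] that
      set_borel_integral_eq_integral(2)[OF borel_integrable_atLeastAtMost'[OF cont[of u]]] by simp
  then show ?thesis
    by (intro has_field_derivative_transform_within[OF D zero_less_one s]) simp
qed

lemma weak_solution_0:
  assumes w: "weak_solution lam mu T f\<^sub>0 f" and A: "A \<in> sets borel"
  shows "measure (f 0) A = measure f\<^sub>0 A"
proof -
  have "(LINT s:{0::real}|lborel. g s) = 0" for g :: "real \<Rightarrow> real"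
    unfolding set_lebesgue_integral_def
    by (rule integral_eq_zero_AE) (use AE_lborel_singleton[of 0] in eventually_elim, auto)
  then show ?thesis
    using weak_solutionD(3)[OF w order_refl A] by simp
qed

text \<open>Both paths start at \<open>f\<^sub>0\<close> and solve the same equation. A bound on
  their gap valid on every Borel set passes through the Lipschitz estimate and a time integration
  into a better bound on every Borel set, and the iterates \<open>(L * s) ^ n / fact n\<close> tend
  to 0. Quantifying over the sets inside the induction avoids a supremum over sets, whose regularity
  in time would need an argument.\<close>

lemma weak_solution_eq_wild_sum:
  assumes lam: "lam > 0" and mu: "mu > 0" and G: "gaussian T \<in> space (prob_algebra borel)"
    and f0: "f\<^sub>0 \<in> space (prob_algebra borel)" and w: "weak_solution lam mu T f\<^sub>0 f" and t: "t \<ge> 0"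
  shows "f t = wild_sum (2 * lam / (2 * lam + mu)) (gaussian T) f\<^sub>0 (1 - exp (- (2 * lam + mu) * t))"
proof -
  define a where "a = 2 * lam + mu"
  define p where "p = 2 * lam / a"
  define W where "W s = wild_sum p (gaussian T) f\<^sub>0 (1 - exp (- a * s))" for s
  have a: "a > 0" using lam mu by (simp add: a_def)
  have ap1: "a * p = 2 * lam" using a by (simp add: p_def)
  then have ap2: "a * (1 - p) = mu" by (simp add: right_diff_distrib) (simp add: a_def)
  have p: "0 \<le> p" "p \<le> 1"
    using lam mu a by (simp add: p_def, subst p_def, subst pos_divide_le_eq) (auto simp: a_def)
  have lm: "lam \<ge> 0" "mu \<ge> 0" using lam mu by auto
  have Wp: "W s \<in> space (prob_algebra borel)" for s
    unfolding W_def by (rule wild_sum_prob_algebra[OF G f0])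
  have WK: "measure (W s) UNIV = 1" "finite_measure (W s)" "sets (W s) = sets borel" for s
  proof -
    show sets: "sets (W s) = sets borel" using Wp[of s] by (simp add: space_prob_algebra)
    interpret P: prob_space "W s" using Wp[of s] by (simp add: space_prob_algebra)
    show "finite_measure (W s)" by (rule P.finite_measure_axioms)
    show "measure (W s) UNIV = 1" using P.prob_space sets_eq_imp_space_eq[OF sets] by simp
  qed
  have DW: "((\<lambda>s. measure (W s) A) has_real_derivative kac_rhs lam mu (gaussian T) (W s) A) (at s within {0..t})"
    if A: "A \<in> sets borel" and s: "s \<in> {0..t}" for A s
  proof -
    have "kac_rhs lam mu (gaussian T) (W s) A = a * (p * measure (rot_conv (W s) (W s)) A
        + (1 - p) * measure (rot_conv (W s) (gaussian T)) A - measure (W s) A)"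
      unfolding kac_rhs_def ap1[symmetric] ap2[symmetric] by (simp add: algebra_simps)
    then have "((\<lambda>s. measure (W s) A) has_real_derivative kac_rhs lam mu (gaussian T) (W s) A) (at s within {0..})"
      using measure_wild_sum_has_derivative[OF G f0 p A a, of s] s unfolding W_def by simp
    then show ?thesis by (rule has_field_derivative_subset) auto
  qed
  obtain K where K1: "K \<ge> 1" and K: "\<And>s. s \<in> {0..t} \<Longrightarrow> measure (f s) UNIV \<le> K"
    using weak_solution_mass_bounded[OF w] by blast
  have fin: "finite_measure (f s)" "sets (f s) = sets borel" if "s \<in> {0..t}" for s
    by (rule finite_borel_measure_finite[OF weak_solutionD(1)[OF w]], use that in simp)+
  define L where "L = 2 * lam * (2 * K + 1) + mu * 2"
  define D where "D A s = measure (f s) A - measure (W s) A" for A s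
  have DD: "(D A has_real_derivative kac_rhs lam mu (gaussian T) (f s) A - kac_rhs lam mu (gaussian T) (W s) A)
      (at s within {0..t})" if "A \<in> sets borel" "s \<in> {0..t}" for A s
    unfolding D_def
    by (rule DERIV_diff[OF weak_solution_has_derivative[OF w lm G that] DW[OF that]])
  have D0: "D A 0 = 0" if "A \<in> sets borel" for A
    using weak_solution_0[OF w that] measure_wild_sum_0[OF G f0 that, of p] by (simp add: D_def W_def)
  have bound: "\<bar>D A s\<bar> \<le> (K + 1) * (L * s) ^ n / fact n" if "A \<in> sets borel" "s \<in> {0..t}" for A s n
    using that
  proof (induction n arbitrary: A s)
    case 0
    \<comment> \<open>The starting constant \<open>K + 1\<close> adds the mass bounds
      \<open>K\<close> for \<open>f s\<close> and 1 for the Wild sum.\<close>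
    have "measure (f s) A \<le> measure (f s) UNIV" "measure (W s) A \<le> measure (W s) UNIV"
      using finite_measure.bounded_measure[OF fin(1)[OF 0(2)], of A]
        finite_measure.bounded_measure[OF WK(2), of s A] fin(2)[OF 0(2)] WK(3)[of s]
      by (auto dest: sets_eq_imp_space_eq)
    then show ?case
      using K[OF 0(2)] WK(1)[of s] by (simp add: D_def) (smt (verit) measure_nonneg)
  next
    case (Suc n)
    show ?case
    proof (cases "s = 0")
      case True
      then show ?thesis by (simp add: D0 Suc)
    next
      case False
      then have s: "0 < s" "s \<le> t" using Suc(3) by auto
      \<comment> \<open>The primitive, vanishing at 0, of \<open>L\<close> times the previous bound;
        the mean value inequality then compares it with the gap.\<close>
      let ?\<phi> = "\<lambda>u. (K + 1) * (L * u) ^ Suc n / fact (Suc n)"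
      have "norm (D A s - D A 0) \<le> ?\<phi> s - ?\<phi> 0"
      proof (rule differentiable_bound_general[OF s(1)])
        show "continuous_on {0..s} (D A)"
          using s by (intro continuous_on_subset[OF DERIV_continuous_on[OF DD[OF Suc(2)]]]) auto
        show "continuous_on {0..s} ?\<phi>" by (intro continuous_intros) auto
        fix u assume u: "0 < u" "u < s"
        show "(D A has_vector_derivative
            kac_rhs lam mu (gaussian T) (f u) A - kac_rhs lam mu (gaussian T) (W u) A) (at u)"
          using DD[OF Suc(2), of u] u s
          by (simp add: has_real_derivative_iff_has_vector_derivative at_within_Icc_at)
        have "(?\<phi> has_real_derivative (K + 1) * (real (Suc n) * (L * u) ^ n * L) / fact (Suc n)) (at u)"
          by (auto intro!: derivative_eq_intros simp del: fact_Suc of_nat_Suc power_Suc)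
        also have "(K + 1) * (real (Suc n) * (L * u) ^ n * L) / fact (Suc n) = L * ((K + 1) * (L * u) ^ n / fact n)"
          by (simp add: field_simps del: of_nat_Suc)
        finally show "(?\<phi> has_vector_derivative L * ((K + 1) * (L * u) ^ n / fact n)) (at u)"
          by (simp add: has_real_derivative_iff_has_vector_derivative del: fact_Suc)
        show "norm (kac_rhs lam mu (gaussian T) (f u) A - kac_rhs lam mu (gaussian T) (W u) A)
            \<le> L * ((K + 1) * (L * u) ^ n / fact n)"
          unfolding real_norm_def
        proof (rule kac_rhs_lipschitz[of lam mu "gaussian T" _ _ K, folded L_def, OF lm G fin(1) WK(2) fin(2) WK(3) K _ Suc(2)])
          show "measure (W u) UNIV \<le> K" using WK K1 by simp
          show "\<bar>measure (f u) B - measure (W u) B\<bar> \<le> (K + 1) * (L * u) ^ n / fact n" if "B \<in> sets borel" for B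
            using Suc.IH[OF that, of u] u s by (simp add: D_def)
        qed (use u s in auto)
      qed
      then show ?thesis by (simp add: D0 Suc del: fact_Suc power_Suc)
    qed
  qed
  have "D A t = 0" if A: "A \<in> sets borel" for A
  proof -
    have "(\<lambda>n. (L * t) ^ n / fact n) \<longlonglongrightarrow> 0"
      using summable_LIMSEQ_zero[OF summable_exp[of "L * t"]] by (simp add: field_simps)
    then have "(\<lambda>n. (K + 1) * ((L * t) ^ n / fact n)) \<longlonglongrightarrow> (K + 1) * 0"
      by (intro tendsto_intros)
    then have "\<bar>D A t\<bar> \<le> (K + 1) * 0"
      by (rule LIMSEQ_le_const) (use bound[OF A, of t] t in auto)
    then show ?thesis by simp
  qed
  then have eq: "measure (f t) A = measure (W t) A" if "A \<in> sets borel" for A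
    using that by (simp add: D_def)
  have "f t = W t"
  proof (rule measure_eqI)
    show "sets (f t) = sets (W t)" using fin(2)[of t] WK(3) t by simp
    fix A assume "A \<in> sets (f t)"
    then have "A \<in> sets borel" using fin(2)[of t] t by simp
    then show "emeasure (f t) A = emeasure (W t) A"
      using eq finite_measure.emeasure_eq_measure[OF fin(1), of t A]
        finite_measure.emeasure_eq_measure[OF WK(2), of t A] t by simp
  qed
  then show ?thesis by (simp add: W_def p_def a_def)
qed

section \<open>Stationarity of the Gaussian and contraction\<close>

lemma gaussian_prob_algebra: "T > 0 \<Longrightarrow> gaussian T \<in> space (prob_algebra borel)"
  by (simp add: gaussian_def space_prob_algebra prob_space_normal_density)

lemma char_gaussian:
  assumes "T > 0"
  shows "char (gaussian T) u = complex_of_real (exp (- (T * u\<^sup>2) / 2))"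
proof -
  interpret N: real_distribution std_normal_distribution by (rule real_dist_normal_dist)
  have "distributed std_normal_distribution lborel (\<lambda>x. x) std_normal_density"
    by (auto simp: distributed_def intro: distr_id2)
  from N.normal_density_affine[OF this, of "sqrt T" 0]
  have "distr std_normal_distribution lborel (\<lambda>x. sqrt T * x) = gaussian T"
    using assms by (simp add: distributed_def gaussian_def)
  then have eq: "gaussian T = distr std_normal_distribution borel (\<lambda>x. sqrt T * x)"
    by (metis distr_cong sets_lborel)
  have "char (gaussian T) u = char std_normal_distribution (sqrt T * u)"
    unfolding eq char_def by (subst integral_distr) (auto simp: mult_ac)
  then show ?thesis
    using assms by (simp add: char_std_normal_distribution power_mult_distrib)
qed

text \<open>At a fixed angle the characteristic function of the collision is the product of the
  Gaussian ones at \<open>u * cos \<theta>\<close> and \<open>u * sin \<theta>\<close>. By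
  \<open>cos^2 + sin^2 = 1\<close> this is the one at \<open>u\<close> whatever the angle, so the
  average over the angle changes nothing.\<close>

lemma rot_conv_gaussian:
  assumes T: "T > 0"
  shows "rot_conv (gaussian T) (gaussian T) = gaussian T"
proof (rule Levy_uniqueness)
  let ?\<gamma> = "gaussian T"
  interpret G: prob_space ?\<gamma> using gaussian_prob_algebra[OF T] by (simp add: space_prob_algebra)
  interpret A: prob_space angle by (rule prob_space_angle)
  have s[measurable_cong]: "sets ?\<gamma> = sets borel" using gaussian_prob_algebra[OF T] by (simp add: space_prob_algebra)
  interpret GA: pair_prob_space ?\<gamma> angle ..
  interpret GGA: pair_prob_space ?\<gamma> "?\<gamma> \<Otimes>\<^sub>M angle" ..
  show "real_distribution ?\<gamma>"
    by unfold_locales (simp_all add: s)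
  show "real_distribution (rot_conv ?\<gamma> ?\<gamma>)"
    using rot_conv_prob_algebra[OF gaussian_prob_algebra[OF T] gaussian_prob_algebra[OF T]]
    by (simp add: space_prob_algebra real_distribution_def real_distribution_axioms_def)
  show "char (rot_conv ?\<gamma> ?\<gamma>) = char ?\<gamma>"
  proof
    fix u
    define \<phi> where "\<phi> v = complex_of_real (exp (- (T * v\<^sup>2) / 2))" for v
    have char: "(CLINT x|?\<gamma>. iexp (v * x)) = \<phi> v" for v
      using char_gaussian[OF T, of v] by (simp add: char_def \<phi>_def)
    have "char (rot_conv ?\<gamma> ?\<gamma>) u =
        (CLINT w|(?\<gamma> \<Otimes>\<^sub>M (?\<gamma> \<Otimes>\<^sub>M angle)). iexp (u * ((\<lambda>(x, y, \<theta>). cos \<theta> *\<^sub>R x + sin \<theta> *\<^sub>R y) w)))"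
      unfolding char_def rot_conv_def
      by (rule integral_distr[OF rotation_measurable[OF s s]]) measurable
    also have "\<dots> = (CLINT w|(?\<gamma> \<Otimes>\<^sub>M (?\<gamma> \<Otimes>\<^sub>M angle)).
        (\<lambda>(x, q). iexp (u * cos (snd q) * x) * iexp (u * sin (snd q) * fst q)) w)"
      by (intro Bochner_Integration.integral_cong refl)
         (auto simp: exp_add[symmetric] algebra_simps)
    also have "\<dots> = (CLINT q|(?\<gamma> \<Otimes>\<^sub>M angle). CLINT x|?\<gamma>. iexp (u * cos (snd q) * x) * iexp (u * sin (snd q) * fst q))"
    proof (rule GGA.integral_snd[symmetric])
      show "integrable (?\<gamma> \<Otimes>\<^sub>M (?\<gamma> \<Otimes>\<^sub>M angle))
          (\<lambda>(x, q). iexp (u * cos (snd q) * x) * iexp (u * sin (snd q) * fst q))"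
        by (rule GGA.integrable_const_bound[where B = 1]) (auto simp: norm_mult)
    qed
    also have "\<dots> = (CLINT q|(?\<gamma> \<Otimes>\<^sub>M angle). (\<lambda>(y, \<theta>). \<phi> (u * cos \<theta>) * iexp (u * sin \<theta> * y)) q)"
      unfolding integral_mult_left_zero char by (simp add: case_prod_beta)
    also have "\<dots> = (CLINT \<theta>|angle. CLINT y|?\<gamma>. \<phi> (u * cos \<theta>) * iexp (u * sin \<theta> * y))"
    proof (rule GA.integral_snd[symmetric])
      have [measurable]: "\<phi> \<in> borel_measurable borel" unfolding \<phi>_def by measurable
      show "integrable (?\<gamma> \<Otimes>\<^sub>M angle) (\<lambda>(y, \<theta>). \<phi> (u * cos \<theta>) * iexp (u * sin \<theta> * y))"
        by (rule GA.integrable_const_bound[where B = 1]) (use T in \<open>auto simp: norm_mult \<phi>_def\<close>)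
    qed
    also have "\<dots> = (CLINT \<theta>|angle. \<phi> (u * cos \<theta>) * \<phi> (u * sin \<theta>))"
      unfolding integral_mult_right_zero char ..
    also have "\<dots> = (CLINT \<theta>|angle. \<phi> u)"
    proof (rule Bochner_Integration.integral_cong[OF refl])
      fix \<theta>
      have "- (T * (u * cos \<theta>)\<^sup>2) / 2 + - (T * (u * sin \<theta>)\<^sup>2) / 2 = - (T * u\<^sup>2) / 2"
        by (simp add: power_mult_distrib cos_squared_eq field_simps)
      then show "\<phi> (u * cos \<theta>) * \<phi> (u * sin \<theta>) = \<phi> u"
        unfolding \<phi>_def of_real_mult[symmetric] exp_add[symmetric] by simp
    qed
    also have "\<dots> = char ?\<gamma> u"
      using A.prob_space by (simp add: char_gaussian[OF T] \<phi>_def)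
    finally show "char (rot_conv ?\<gamma> ?\<gamma>) u = char ?\<gamma> u" .
  qed
qed

lemma tv_dist_self: "tv_dist M M = 0"
proof -
  \<comment> \<open>The supremum of the constant 0 is 0 only over a nonempty index set; the trivial
    partition provides an element.\<close>
  have "{P. finite P \<and> partition_on (UNIV :: real set) P \<and> P \<subseteq> sets borel} \<noteq> {}"
    by (auto intro!: exI[of _ "{UNIV}"] simp: partition_on_def disjoint_def)
  then show ?thesis by (simp add: tv_dist_def)
qed

lemma weak_solution_gaussian:
  assumes T: "T > 0"
  shows "weak_solution lam mu T (gaussian T) (\<lambda>t. gaussian T)"
proof -
  have fb: "finite_borel_measure (gaussian T)"
    by (rule finite_borel_measure_prob_algebra[OF gaussian_prob_algebra[OF T]])
  show ?thesis
    unfolding weak_solution_def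
    by (simp add: fb tv_dist_self collision_eq_rot_conv rot_conv_gaussian[OF T])
qed

section \<open>The squared Wasserstein distance through joint laws\<close>

lemma W2_power2:
  "(W2 f g)\<^sup>2 = (INF (M, X, Y) \<in> {(M :: (real \<times> real) measure, X, Y).
          prob_space M \<and> X \<in> borel_measurable M \<and> Y \<in> borel_measurable M \<and>
          distr M borel X = f \<and> distr M borel Y = g}.
        \<integral>\<^sup>+\<omega>. ennreal ((X \<omega> - Y \<omega>)\<^sup>2) \<partial>M)"
  by (simp only: W2_def ennreal_sqrt_power2)

lemma measurable_fst_snd_borel:
  "fst \<in> borel_measurable (borel :: (real \<times> real) measure)"
  "snd \<in> borel_measurable (borel :: (real \<times> real) measure)"
  by (intro borel_measurable_continuous_onI continuous_intros)+

lemma W2_power2_le_quadratic_cost: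
  assumes F: "F \<in> space (prob_algebra borel)"
  shows "(W2 (distr F borel fst) (distr F borel snd))\<^sup>2 \<le> quadratic_cost F"
proof -
  have sF: "prob_space F" "sets F = sets borel" using F by (auto simp: space_prob_algebra)
  have "fst \<in> borel_measurable F" "snd \<in> borel_measurable F"
    using measurable_fst_snd_borel by (simp_all add: measurable_cong_sets[OF sF(2) refl])
  then show ?thesis
    unfolding W2_power2 quadratic_cost_def
    using sF(1) by (intro INF_lower2[of "(F, fst, snd)"]) auto
qed

text \<open>Any admissible triple is replaced by its joint law. The factor \<open>c\<close> is first
  moved to the other side as \<open>1 / c\<close>, so that what is tested is a lower bound of the
  infimum itself.\<close>

lemma W2_power2_greatest:
  assumes c: "c > 0"
    and le: "\<And>F. F \<in> space (prob_algebra borel) \<Longrightarrow> distr F borel fst = f \<Longrightarrow> distr F borel snd = g \<Longrightarrow>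
      x \<le> ennreal c * quadratic_cost F"
  shows "x \<le> ennreal c * (W2 f g)\<^sup>2"
proof -
  have cc: "ennreal c * (ennreal (1 / c) * x) = x"
    using c by (simp add: mult.assoc[symmetric] ennreal_mult[symmetric])
  have "ennreal (1 / c) * x \<le> (W2 f g)\<^sup>2"
    unfolding W2_power2
  proof (rule INF_greatest, clarsimp)
    fix M :: "(real \<times> real) measure" and X Y
    assume M: "prob_space M" and [measurable]: "X \<in> borel_measurable M" "Y \<in> borel_measurable M"
      and f: "f = distr M borel X" and g: "g = distr M borel Y"
    let ?F = "distr M borel (\<lambda>\<omega>. (X \<omega>, Y \<omega>))"
    have m: "(\<lambda>\<omega>. (X \<omega>, Y \<omega>)) \<in> borel_measurable M" by (rule borel_measurable_Pair) measurable
    have "?F \<in> space (prob_algebra borel)"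
      using prob_space.prob_space_distr[OF M m] by (simp add: space_prob_algebra)
    moreover have "distr ?F borel fst = f" "distr ?F borel snd = g"
      by (simp_all add: distr_distr measurable_fst_snd_borel m comp_def f g)
    moreover have "quadratic_cost ?F = (\<integral>\<^sup>+\<omega>. ennreal ((X \<omega> - Y \<omega>)\<^sup>2) \<partial>M)"
      unfolding quadratic_cost_def
      by (subst nn_integral_distr[OF m]) (simp_all add: quadratic_cost_measurable)
    ultimately have "x \<le> ennreal c * (\<integral>\<^sup>+\<omega>. ennreal ((X \<omega> - Y \<omega>)\<^sup>2) \<partial>M)"
      using le by metis
    then have "ennreal c * (ennreal (1 / c) * x) \<le> ennreal c * (\<integral>\<^sup>+\<omega>. ennreal ((X \<omega> - Y \<omega>)\<^sup>2) \<partial>M)"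
      unfolding cc .
    then show "ennreal (1 / c) * x \<le> (\<integral>\<^sup>+\<omega>. ennreal ((X \<omega> - Y \<omega>)\<^sup>2) \<partial>M)"
      using c by (subst (asm) ennreal_mult_le_mult_iff) auto
  qed
  then have "ennreal c * (ennreal (1 / c) * x) \<le> ennreal c * (W2 f g)\<^sup>2"
    by (rule mult_left_mono) simp
  then show ?thesis unfolding cc .
qed

lemma weak_solution_contraction:
  assumes lam: "lam > 0" and mu: "mu > 0" and T: "T > 0"
    and f0: "f\<^sub>0 \<in> space (prob_algebra borel)" and g0: "g\<^sub>0 \<in> space (prob_algebra borel)"
    and f: "weak_solution lam mu T f\<^sub>0 f" and g: "weak_solution lam mu T g\<^sub>0 g" and t: "t \<ge> 0"
  shows "(W2 (f t) (g t))\<^sup>2 \<le> ennreal (exp (- (mu / 2) * t)) * (W2 f\<^sub>0 g\<^sub>0)\<^sup>2"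
proof (rule W2_power2_greatest)
  fix F :: "(real \<times> real) measure"
  assume F: "F \<in> space (prob_algebra borel)" and marg: "distr F borel fst = f\<^sub>0" "distr F borel snd = g\<^sub>0"
  define a where "a = 2 * lam + mu"
  define p where "p = 2 * lam / a"
  let ?x = "1 - exp (- a * t)"
  have a: "a > 0" using lam mu by (simp add: a_def)
  have ap: "a * (1 - p) = mu"
    using a by (simp add: p_def right_diff_distrib) (simp add: a_def)
  have p0: "0 \<le> p" using lam a by (simp add: p_def)
  have p1: "p \<le> 1" unfolding p_def using a mu by (subst pos_divide_le_eq) (auto simp: a_def)
  have x: "0 \<le> ?x" "?x < 1" using a t by auto
  note gT = gaussian_prob_algebra[OF T]
  \<comment> \<open>Both coordinates collide with the same thermostat particle: each marginal is the
    Gaussian, and the cost is 0.\<close>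
  define G where "G = distr (gaussian T) borel (\<lambda>w. (w, w))"
  have m: "(\<lambda>w::real. (w, w)) \<in> borel_measurable borel"
    by (intro borel_measurable_continuous_onI continuous_intros)
  have m': "(\<lambda>w::real. (w, w)) \<in> borel_measurable (gaussian T)"
    using gT m by (simp add: space_prob_algebra cong: measurable_cong_sets)
  have G: "G \<in> space (prob_algebra borel)"
    unfolding G_def by (rule distr_prob_algebra[OF gT m])
  have G0: "quadratic_cost G = 0"
    unfolding G_def quadratic_cost_def
    by (subst nn_integral_distr[OF m']) (simp_all add: quadratic_cost_measurable)
  have margG: "distr G borel fst = gaussian T" "distr G borel snd = gaussian T"
    using gT by (simp_all add: G_def distr_distr[OF _ m'] measurable_fst_snd_borel comp_def space_prob_algebra distr_id2)
  let ?F = "wild_sum p G F ?x"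
  have "distr ?F borel fst = wild_sum p (gaussian T) f\<^sub>0 ?x"
    using distr_wild_sum[OF G F bounded_linear.linear[OF bounded_linear_fst] measurable_fst_snd_borel(1)]
    by (simp add: margG marg)
  also have "\<dots> = f t"
    using weak_solution_eq_wild_sum[OF lam mu gT f0 f t] by (simp add: p_def a_def)
  finally have Ff: "distr ?F borel fst = f t" .
  have "distr ?F borel snd = wild_sum p (gaussian T) g\<^sub>0 ?x"
    using distr_wild_sum[OF G F bounded_linear.linear[OF bounded_linear_snd] measurable_fst_snd_borel(2)]
    by (simp add: margG marg)
  also have "\<dots> = g t"
    using weak_solution_eq_wild_sum[OF lam mu gT g0 g t] by (simp add: p_def a_def)
  finally have Fg: "distr ?F borel snd = g t" .
  \<comment> \<open>Only \<open>a * (1 - p)\<close> enters the exponent, so the collision rate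
    \<open>lam\<close> drops out of the decay.\<close>
  have "(1 - ?x) powr ((1 - p) / 2) = exp (- (a * (1 - p) / 2) * t)"
    by (simp add: powr_def field_simps)
  then have rate: "(1 - ?x) powr ((1 - p) / 2) = exp (- (mu / 2) * t)"
    unfolding ap .
  show "(W2 (f t) (g t))\<^sup>2 \<le> ennreal (exp (- (mu / 2) * t)) * quadratic_cost F"
    using W2_power2_le_quadratic_cost[OF wild_sum_prob_algebra[OF G F, of p ?x]]
    unfolding Ff Fg quadratic_cost_wild_sum[OF G F p0 p1 G0 x] rate .
qed simp

theorem lemma9:
  fixes lam mu T :: real
    and f\<^sub>0 g\<^sub>0 :: "real measure"
    and f g :: "real \<Rightarrow> real measure"
  assumes "lam > 0" "mu > 0" "T > 0"
    and "real_distribution f\<^sub>0" "real_distribution g\<^sub>0"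
    and "weak_solution lam mu T f\<^sub>0 f" "weak_solution lam mu T g\<^sub>0 g"
  shows "(\<forall>t\<ge>0. (W2 (f t) (g t))\<^sup>2 \<le> ennreal (exp (- (mu / 2) * t)) * (W2 f\<^sub>0 g\<^sub>0)\<^sup>2) \<and>
         (\<forall>t\<ge>0. (W2 (f t) (gaussian T))\<^sup>2 \<le>
                  ennreal (exp (- (mu / 2) * t)) * (W2 f\<^sub>0 (gaussian T))\<^sup>2)"
  using weak_solution_contraction[OF assms(1-3) real_distribution_prob_algebra[OF assms(4)]
      real_distribution_prob_algebra[OF assms(5)] assms(6,7)]
    weak_solution_contraction[OF assms(1-3) real_distribution_prob_algebra[OF assms(4)]
      gaussian_prob_algebra[OF assms(3)] assms(6) weak_solution_gaussian[OF assms(3)]]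
  by blast

end
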